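(* Let $q\in(0,1)$. There exist constants $C_q>0$ and $\alpha_q\in(0,1)$ depending only on $q$ such that the following holds for every even integer $k\ge2$. Put $\omega:=k$, $n:=2k$, $c:=\frac{2\omega}{\pi(1-q+k)}$, and for $1\le j\le n+1$ $$c_j=\begin{cases}c(1-q)& j\text{ odd},\\ c(1+q)& j\text{ even},\end{cases}\qquad h_j=\frac{c_j}{\omega}\pi\times\begin{cases}1& j=k+1,\\ \tfrac12&\text{otherwise},\end{cases}$$ $x_0:=-1$ and $x_j:=x_{j-1}+h_j$ (so that $x_{n+1}=1$). Let $\mathbf{c}$ denote the piecewise constant wave speed with value $c_j$ on $(x_{j-1},x_j)$. Then the solution $u$ of $$-u''-\left(\tfrac{\omega}{\mathbf{c}}\right)^2u=0\ \text{ in }\Omega=(-1,1),\qquad -u'-\mathrm{i}\tfrac{\omega}{c_1}u=0\ \text{ at }x=-1,\qquad u'-\mathrm{i}\tfrac{\omega}{c_{n+1}}u=1\ \text{ at }x=1$$ satisfies $$\left(\int_\Omega|u'|^2+\left(\tfrac{\omega}{\mathbf{c}}\right)^2|u|^2\right)^{1/2}\ge C_q\,\alpha_q^{-\omega}.$$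
   Context: The solution is the unique $u\in H^1(\Omega)$ with $$\int_\Omega\left(u'\bar v'-\left(\tfrac{\omega}{\mathbf{c}}\right)^2u\bar v\right)-\mathrm{i}\sum_{x\in\{-1,1\}}\tfrac{\omega}{\mathbf{c}(x)}u(x)\bar v(x)=\bar v(1)\qquad\forall v\in H^1(\Omega),$$ with $\mathbf{c}(-1)=c_1$, $\mathbf{c}(1)=c_{n+1}$. *)

theory Defs
  imports "HOL-Analysis.Analysis"
begin

abbreviation Omega :: "real set" where
  "Omega \<equiv> {-1<..<1}"

definition L2 :: "(real \<Rightarrow> complex) \<Rightarrow> bool" where
  "L2 f \<longleftrightarrow> set_borel_measurable lebesgue Omega f \<and>
     set_integrable lebesgue Omega (\<lambda>x. (cmod (f x))\<^sup>2)"

text \<open>Real-valued test functions suffice: the defining identity of a weak derivative is linear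
  in the test function, so it extends to complex-valued ones.\<close>

definition test_function :: "(real \<Rightarrow> real) \<Rightarrow> bool" where
  "test_function \<phi> \<longleftrightarrow> (\<forall>m. ((deriv ^^ m) \<phi>) differentiable_on UNIV) \<and>
     compact (closure {x. \<phi> x \<noteq> 0}) \<and> closure {x. \<phi> x \<noteq> 0} \<subseteq> Omega"

definition has_weak_deriv :: "(real \<Rightarrow> complex) \<Rightarrow> (real \<Rightarrow> complex) \<Rightarrow> bool" where
  "has_weak_deriv u g \<longleftrightarrow> (\<forall>\<phi>. test_function \<phi> \<longrightarrow>
     (LINT x:Omega|lebesgue. deriv \<phi> x *\<^sub>R u x) = - (LINT x:Omega|lebesgue. \<phi> x *\<^sub>R g x))"

text \<open>An element of the Sobolev space is an almost-everywhere class of functions on the open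
  interval. In dimension one each class has exactly one representative that extends
  continuously to the closed interval, and the point values at the two endpoints (the traces)
  are values of that extension. A class is encoded by this representative.\<close>

definition H1 :: "(real \<Rightarrow> complex) \<Rightarrow> bool" where
  "H1 u \<longleftrightarrow> continuous_on {-1..1} u \<and> L2 u \<and> (\<exists>g. L2 g \<and> has_weak_deriv u g)"

text \<open>A weak derivative is unique up to a null set, so the choice does not affect integrals.\<close>

definition weak_deriv :: "(real \<Rightarrow> complex) \<Rightarrow> real \<Rightarrow> complex" where
  "weak_deriv u = (SOME g. L2 g \<and> has_weak_deriv u g)"

definition helmholtz_form ::
    "real \<Rightarrow> (real \<Rightarrow> real) \<Rightarrow> (real \<Rightarrow> complex) \<Rightarrow> (real \<Rightarrow> complex) \<Rightarrow> complex" where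
  "helmholtz_form \<omega> cs u v =
     (LINT x:Omega|lebesgue. weak_deriv u x * cnj (weak_deriv v x)
        - complex_of_real ((\<omega> / cs x)\<^sup>2) * u x * cnj (v x))
     - \<i> * (\<Sum>x\<in>{-1, 1}. complex_of_real (\<omega> / cs x) * u x * cnj (v x))"

text \<open>Variational form of the Helmholtz problem with impedance data 0 at -1 and 1 at 1.\<close>

definition helmholtz_solution :: "real \<Rightarrow> (real \<Rightarrow> real) \<Rightarrow> (real \<Rightarrow> complex) \<Rightarrow> bool" where
  "helmholtz_solution \<omega> cs u \<longleftrightarrow>
     H1 u \<and> (\<forall>v. H1 v \<longrightarrow> helmholtz_form \<omega> cs u v = cnj (v 1))"

definition energy_norm :: "real \<Rightarrow> (real \<Rightarrow> real) \<Rightarrow> (real \<Rightarrow> complex) \<Rightarrow> real" where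
  "energy_norm \<omega> cs u =
     sqrt (LINT x:Omega|lebesgue. (cmod (weak_deriv u x))\<^sup>2 + (\<omega> / cs x)\<^sup>2 * (cmod (u x))\<^sup>2)"

definition layer_speed :: "real \<Rightarrow> nat \<Rightarrow> nat \<Rightarrow> real" where
  "layer_speed q k j =
     (let \<omega> = real k; c = 2 * \<omega> / (pi * (1 - q + real k))
      in if odd j then c * (1 - q) else c * (1 + q))"

definition layer_width :: "real \<Rightarrow> nat \<Rightarrow> nat \<Rightarrow> real" where
  "layer_width q k j =
     layer_speed q k j / real k * pi * (if j = k + 1 then 1 else 1 / 2)"

primrec node :: "real \<Rightarrow> nat \<Rightarrow> nat \<Rightarrow> real" where
  "node q k 0 = -1"
| "node q k (Suc j) = node q k j + layer_width q k (Suc j)"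

text \<open>Values at the interior nodes are left arbitrary; they form a null set. The endpoint
  values enter the boundary terms of the variational form.\<close>

definition layered_speed :: "nat \<Rightarrow> (nat \<Rightarrow> real) \<Rightarrow> (nat \<Rightarrow> real) \<Rightarrow> (real \<Rightarrow> real) \<Rightarrow> bool" where
  "layered_speed N xs c cs \<longleftrightarrow>
     (\<forall>j\<in>{1..N}. \<forall>y\<in>{xs (j - 1)<..<xs j}. cs y = c j) \<and> cs (-1) = c 1 \<and> cs 1 = c N"

end

theory Submission
  imports Defs
begin

text \<open>The estimate is obtained by duality. The variational identity is tested with the conjugate of a
  continuously differentiable, layerwise trigonometric function \<open>Z\<close> that satisfies the impedance
  conditions \<open>Z' = - \<i> a Z\<close> at \<open>-1\<close> and \<open>Z' = \<i> a Z\<close> at \<open>1\<close>, where \<open>a = \<omega> / c\<^sub>1\<close>, and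
  \<open>\<bar>Z 1\<bar> = 1\<close>. All layers but the central one are a quarter wave wide, so crossing an odd and then an
  even layer multiplies \<open>(Z, Z')\<close> by \<open>(- 1 / r, - r)\<close> with \<open>r = (1 - q) / (1 + q)\<close>. Starting from the
  impedance data at \<open>-1\<close>, the derivative has decayed to \<open>a r^(k/2)\<close> when the central layer is reached.
  The exact solution would leave this half-wave layer with \<open>(- Z, - Z')\<close> and then violate the condition
  at \<open>1\<close>. Replacing \<open>sin s\<close> by \<open>sin (2 s) / 2\<close> in the component carrying the derivative yields
  \<open>(- Z, Z')\<close> instead, which meets the condition, at the price of a defect of order \<open>a\<^sup>2 r^(k/2)\<close>
  supported in the central layer. Hence \<open>1 = \<bar>Z 1\<bar>\<close> is at most this defect times the \<open>L\<^sup>1\<close> norm of \<open>u\<close>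
  there, which forces the energy norm of \<open>u\<close> to be exponentially large.\<close>

section \<open>Smooth test functions\<close>

text \<open>The power in front of the exponential makes the family closed under differentiation up
  to linear combinations: differentiating only raises the index.\<close>

definition flat :: "nat \<Rightarrow> real \<Rightarrow> real" where
  "flat n x = (if x > 0 then (1 / x) ^ n * exp (- (1 / x)) else 0)"

lemma flat_pos: "x > 0 \<Longrightarrow> flat n x > 0"
  by (simp add: flat_def)

lemma flat_nonneg: "flat n x \<ge> 0"
  by (simp add: flat_def)

lemma flat_eq_0: "x \<le> 0 \<Longrightarrow> flat n x = 0"
  by (simp add: flat_def)

text \<open>With \<open>y = 1 / x\<close> this is the decay of \<open>y ^ n / exp y\<close> at
  infinity.\<close>

lemma flat_tendsto_0: "(flat n \<longlongrightarrow> 0) (at_right 0)"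
proof -
  have "((\<lambda>y::real. y ^ n / exp y) \<longlongrightarrow> 0) at_top"
    by (rule tendsto_power_div_exp_0)
  then have "((\<lambda>x::real. (inverse x) ^ n / exp (inverse x)) \<longlongrightarrow> 0) (at_right 0)"
    by (rule filterlim_compose[OF _ filterlim_inverse_at_top_right])
  moreover have "\<forall>\<^sub>F x::real in at_right 0. (inverse x) ^ n / exp (inverse x) = flat n x"
    unfolding eventually_at_right_field
    by (intro exI[of _ 1]) (auto simp: flat_def exp_minus field_simps)
  ultimately show ?thesis
    by (rule Lim_transform_eventually)
qed

lemma has_real_derivative_flat:
  "(flat n has_real_derivative flat (n + 2) x - real n * flat (n + 1) x) (at x)"
proof (cases x "0::real" rule: linorder_cases)
  case less
  have "((\<lambda>_. 0) has_real_derivative 0) (at x)"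
    by simp
  then have "(flat n has_real_derivative 0) (at x)"
    by (rule has_field_derivative_transform_within_open[where S = "{..<0}"])
       (use less in \<open>auto simp: flat_def\<close>)
  then show ?thesis
    using less by (simp add: flat_def)
next
  case equal
  have "((\<lambda>y. flat (n + 1) y) \<longlongrightarrow> 0) (at_right 0)"
    by (rule flat_tendsto_0)
  \<comment> \<open>Dividing by \<open>y\<close> only raises the power, so the right difference
    quotient at 0 is again a member of the family and tends to 0.\<close>
  moreover have "\<forall>\<^sub>F y in at_right 0. flat (n + 1) y = (flat n y - flat n 0) / (y - 0)"
    unfolding eventually_at_right_field by (intro exI[of _ 1]) (auto simp: flat_def)
  ultimately have R: "((\<lambda>y. (flat n y - flat n 0) / (y - 0)) \<longlongrightarrow> 0) (at_right 0)"
    by (rule Lim_transform_eventually)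
  have "\<forall>\<^sub>F y in at_left 0. 0 = (flat n y - flat n 0) / (y - 0)"
    unfolding eventually_at_left_field by (intro exI[of _ "-1"]) (auto simp: flat_def)
  then have L: "((\<lambda>y. (flat n y - flat n 0) / (y - 0)) \<longlongrightarrow> 0) (at_left 0)"
    by (rule Lim_transform_eventually[OF tendsto_const])
  have "((\<lambda>y. (flat n y - flat n 0) / (y - 0)) \<longlongrightarrow> 0) (at 0)"
    by (rule filterlim_split_at[OF L R])
  then show ?thesis
    using equal by (simp add: has_field_derivative_iff flat_def)
next
  case greater
  have "((\<lambda>x. (1 / x) ^ n * exp (- (1 / x))) has_real_derivative
      real n * (1 / x) ^ (n - 1) * (- (1 / (x * x))) * exp (- (1 / x)) +
      exp (- (1 / x)) * (1 / (x * x)) * (1 / x) ^ n) (at x)"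
    using greater by (auto intro!: derivative_eq_intros)
  also have "real n * (1 / x) ^ (n - 1) * (- (1 / (x * x))) = - (real n * (1 / x) ^ (n + 1))"
    by (cases n) simp_all
  also have "exp (- (1 / x)) * (1 / (x * x)) * (1 / x) ^ n = (1 / x) ^ (n + 2) * exp (- (1 / x))"
    by simp
  finally have "((\<lambda>x. (1 / x) ^ n * exp (- (1 / x))) has_real_derivative
      flat (n + 2) x - real n * flat (n + 1) x) (at x)"
    using greater by (simp add: flat_def mult.assoc)
  then show ?thesis
    by (rule has_field_derivative_transform_within_open[where S = "{0<..}"])
       (use greater in \<open>auto simp: flat_def\<close>)
qed

text \<open>The derivative of every generator lies in the class again and the closure conditions preserve
  this, so members are infinitely differentiable without appeal to a Leibniz formula.\<close>

inductive smooth_fn :: "(real \<Rightarrow> real) \<Rightarrow> bool" where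
  flat: "smooth_fn (flat n)"
| const: "smooth_fn (\<lambda>x. c)"
| cos: "smooth_fn (\<lambda>x. cos (x + c))"
| add: "smooth_fn f \<Longrightarrow> smooth_fn g \<Longrightarrow> smooth_fn (\<lambda>x. f x + g x)"
| mult: "smooth_fn f \<Longrightarrow> smooth_fn g \<Longrightarrow> smooth_fn (\<lambda>x. f x * g x)"
| affine: "smooth_fn f \<Longrightarrow> smooth_fn (\<lambda>x. f (m * x + c))"
| antideriv: "smooth_fn f \<Longrightarrow> (\<And>x. (g has_real_derivative f x) (at x)) \<Longrightarrow> smooth_fn g"

lemma smooth_fn_cmult: "smooth_fn f \<Longrightarrow> smooth_fn (\<lambda>x. c * f x)"
  by (rule smooth_fn.mult[OF smooth_fn.const])

lemma smooth_fn_diff: "smooth_fn f \<Longrightarrow> smooth_fn g \<Longrightarrow> smooth_fn (\<lambda>x. f x - g x)"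
  using smooth_fn.add[OF _ smooth_fn_cmult[of g "-1"]] by simp

lemma smooth_fn_has_derivative:
  assumes "smooth_fn f"
  shows "\<exists>f'. smooth_fn f' \<and> (\<forall>x. (f has_real_derivative f' x) (at x))"
  using assms
proof induction
  case (flat n)
  show ?case
    by (intro exI[of _ "\<lambda>x. flat (n + 2) x - real n * flat (n + 1) x"] conjI allI
        smooth_fn_diff smooth_fn_cmult smooth_fn.flat has_real_derivative_flat)
next
  case (const c)
  show ?case
    by (intro exI[of _ "\<lambda>x. 0"] conjI allI smooth_fn.const) auto
next
  case (cos c)
  have "cos (x + (c + pi / 2)) = - sin (x + c)" for x
    using minus_sin_cos_eq[of "x + c"] by (simp add: add_ac)
  then show ?case
    by (intro exI[of _ "\<lambda>x. cos (x + (c + pi / 2))"] conjI allI smooth_fn.cos)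
       (auto intro!: derivative_eq_intros)
next
  case (add f g)
  then obtain f' g' where "smooth_fn f'" "\<forall>x. (f has_real_derivative f' x) (at x)"
    "smooth_fn g'" "\<forall>x. (g has_real_derivative g' x) (at x)"
    by blast
  then show ?case
    by (intro exI[of _ "\<lambda>x. f' x + g' x"] conjI allI smooth_fn.add DERIV_add) auto
next
  case (mult f g)
  then obtain f' g' where f'g': "smooth_fn f'" "\<forall>x. (f has_real_derivative f' x) (at x)"
    "smooth_fn g'" "\<forall>x. (g has_real_derivative g' x) (at x)"
    by blast
  with mult.hyps have "smooth_fn (\<lambda>x. f' x * g x + g' x * f x)"
    using f'g' by (intro smooth_fn.add[OF smooth_fn.mult smooth_fn.mult])
  then show ?case
    using f'g' by (intro exI[of _ "\<lambda>x. f' x * g x + g' x * f x"] conjI allI DERIV_mult) auto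
next
  case (affine f m c)
  then obtain f' where f': "smooth_fn f'" "\<And>x. (f has_real_derivative f' x) (at x)"
    by blast
  have "((\<lambda>x. f (m * x + c)) has_real_derivative m * f' (m * x + c)) (at x)" for x
    by (rule DERIV_chain'[THEN DERIV_cong, OF _ f'(2)]) (auto intro!: derivative_eq_intros)
  then show ?case
    by (intro exI[of _ "\<lambda>x. m * f' (m * x + c)"] conjI allI smooth_fn_cmult
        smooth_fn.affine[OF f'(1)])
next
  case (antideriv f g)
  then show ?case by blast
qed

lemma smooth_fn_deriv:
  assumes "smooth_fn f"
  shows "smooth_fn (deriv f)" "(f has_real_derivative deriv f x) (at x)"
proof -
  obtain f' where f': "smooth_fn f'" "\<And>x. (f has_real_derivative f' x) (at x)"
    using smooth_fn_has_derivative[OF assms] by blast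
  then have "deriv f = f'"
    by (auto intro!: DERIV_imp_deriv)
  with f' show "smooth_fn (deriv f)" "(f has_real_derivative deriv f x) (at x)"
    by auto
qed

lemma smooth_fn_iterated_deriv: "smooth_fn f \<Longrightarrow> smooth_fn ((deriv ^^ m) f)"
  by (induction m) (auto intro: smooth_fn_deriv)

lemma smooth_fn_continuous_on: "smooth_fn f \<Longrightarrow> continuous_on S f"
  by (rule DERIV_continuous_on[OF has_field_derivative_at_within[OF smooth_fn_deriv(2)]])

lemma smooth_fn_imp_test_function:
  assumes "smooth_fn f" "-1 < a" "b < 1" "\<And>x. x \<notin> {a..b} \<Longrightarrow> f x = 0"
  shows "test_function f"
proof -
  have "((deriv ^^ m) f) differentiable_on UNIV" for m
    using smooth_fn_deriv(2)[OF smooth_fn_iterated_deriv[OF assms(1)], of m]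
    by (intro differentiable_at_imp_differentiable_on) (auto simp: real_differentiable_def)
  moreover have sub: "closure {x. f x \<noteq> 0} \<subseteq> {a..b}"
    by (rule closure_minimal) (use assms(4) in blast, simp)
  moreover have "compact (closure {x. f x \<noteq> 0})"
    using bounded_subset[OF bounded_closed_interval sub] by (simp add: compact_eq_bounded_closed)
  ultimately show ?thesis
    using assms(2,3) by (fastforce simp: test_function_def)
qed

text \<open>Vanishing left of 0 lets the single base point -1 serve the whole line. For
  \<open>x < 0\<close> the integral is locally 0, over an empty interval if \<open>x < -1\<close>;
  for \<open>x >= 0\<close> the point is interior to \<open>{-1..x + 1}\<close>, so the one-sided
  fundamental theorem gives a two-sided derivative.\<close>

lemma continuous_left_zero_antiderivative:
  fixes f :: "real \<Rightarrow> real"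
  assumes cont: "continuous_on UNIV f" and zero: "\<And>x. x \<le> 0 \<Longrightarrow> f x = 0"
  shows "((\<lambda>x. integral {-1..x} f) has_real_derivative f x) (at x)"
proof (cases "x < 0")
  case True
  have "integral {-1..y} f = 0" if "y < 0" for y
    using that zero by (intro integral_unique has_integral_is_0) auto
  then have "((\<lambda>x. integral {-1..x} f) has_real_derivative 0) (at x)"
    by (intro has_field_derivative_transform_within_open[OF DERIV_const, where S = "{..<0}"])
       (use True in auto)
  then show ?thesis
    using True zero by simp
next
  case False
  have "((\<lambda>x. integral {-1..x} f) has_real_derivative f x) (at x within {-1..x + 1})"
    using False by (intro integral_has_real_derivative continuous_on_subset[OF cont]) auto
  then show ?thesis
    using False at_within_Icc_at[of "-1" x "x + 1"] by simp
qed

text \<open>\<open>K\<close> is a normalised bump on the unit interval and \<open>H\<close> its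
  antiderivative. Differences of rescaled copies of \<open>H\<close> approximate indicators of
  intervals, and rescaled copies of \<open>K\<close> are approximate identities at the interval
  ends.\<close>

lemma smooth_step_exists:
  obtains H K where "smooth_fn H" "\<And>x. (H has_real_derivative K x) (at x)"
    "\<And>x. x \<le> 0 \<Longrightarrow> H x = 0" "\<And>x. x \<ge> 1 \<Longrightarrow> H x = 1" "\<And>x. 0 \<le> H x" "\<And>x. H x \<le> 1"
    "smooth_fn K" "\<And>x. 0 \<le> K x" "\<And>x. x \<le> 0 \<or> 1 \<le> x \<Longrightarrow> K x = 0"
proof -
  \<comment> \<open>The first factor vanishes on the left of 0 and the second on the right of 1, so
    the product is positive exactly on the open unit interval.\<close>
  define \<eta> where "\<eta> = (\<lambda>x. flat 0 x * flat 0 (-1 * x + 1))"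
  have \<eta>: "smooth_fn \<eta>"
    unfolding \<eta>_def
    by (rule smooth_fn.mult[OF smooth_fn.flat smooth_fn.affine[OF smooth_fn.flat]])
  have \<eta>0: "\<eta> x \<ge> 0" for x
    unfolding \<eta>_def by (simp add: flat_nonneg)
  have \<eta>_pos: "\<eta> x > 0" if "0 < x" "x < 1" for x
    unfolding \<eta>_def using that by (simp add: flat_pos)
  have \<eta>_out: "\<eta> x = 0" if "x \<le> 0 \<or> 1 \<le> x" for x
    unfolding \<eta>_def using that by (auto simp: flat_eq_0)
  define G where "G = (\<lambda>x. integral {-1..x} \<eta>)"
  have G: "(G has_real_derivative \<eta> x) (at x)" for x
    unfolding G_def
    by (rule continuous_left_zero_antiderivative[OF smooth_fn_continuous_on[OF \<eta>]])
       (use \<eta>_out in auto)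
  have mono: "G x \<le> G y" if "x \<le> y" for x y
    using DERIV_nonneg_imp_nondecreasing[OF that] G \<eta>0 by blast
  have G0: "G x = 0" if "x \<le> 0" for x
    unfolding G_def using that \<eta>_out by (intro integral_unique has_integral_is_0) auto
  have Gc: "continuous_on S G" for S
    by (rule smooth_fn_continuous_on[OF smooth_fn.antideriv[OF \<eta> G]])
  have "G 0 < G 1"
    by (rule DERIV_pos_imp_increasing_open[of 0 1])
       (use G \<eta>_pos Gc in auto)
  then have G1: "G 1 > 0"
    by (simp add: G0)
  have G_ge_1: "G x = G 1" if "x \<ge> 1" for x
  proof (cases "x = 1")
    case False
    have "(G has_real_derivative 0) (at y)" if "1 < y" for y
      using G[of y] \<eta>_out[of y] that by simp
    then show ?thesis
      using that False Gc
      by (intro DERIV_isconst_end[of 1 x]) auto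
  qed simp
  show ?thesis
  proof (rule that)
    show "smooth_fn (\<lambda>x. 1 / G 1 * G x)"
      by (rule smooth_fn_cmult[OF smooth_fn.antideriv[OF \<eta> G]])
    show "((\<lambda>x. 1 / G 1 * G x) has_real_derivative 1 / G 1 * \<eta> x) (at x)" for x
      by (rule DERIV_cmult[OF G])
    show "0 \<le> 1 / G 1 * \<eta> x" for x
      using \<eta>0 G1 by simp
    show "smooth_fn (\<lambda>x. 1 / G 1 * \<eta> x)"
      by (rule smooth_fn_cmult[OF \<eta>])
    show "1 / G 1 * \<eta> x = 0" if "x \<le> 0 \<or> 1 \<le> x" for x
      using \<eta>_out[OF that] by simp
    show "1 / G 1 * G x = 0" if "x \<le> 0" for x
      using G0[OF that] by simp
    show "1 / G 1 * G x = 1" if "x \<ge> 1" for x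
      using G_ge_1[OF that] G1 by simp
    show "0 \<le> 1 / G 1 * G x" for x
      using mono[of 0 x] mono[of x 0] G0[of x] G0[of 0] G1 by (cases "x \<ge> 0") auto
    show "1 / G 1 * G x \<le> 1" for x
      using mono[of x 1] G_ge_1[of x] G1 by (cases "x \<ge> 1") auto
  qed
qed

section \<open>Weak derivatives on the interval\<close>

lemma absolutely_integrable_scaleR_continuous:
  fixes f :: "real \<Rightarrow> real" and g :: "real \<Rightarrow> 'a::euclidean_space"
  assumes "continuous_on {a..b} f" "g absolutely_integrable_on {a..b}"
  shows "(\<lambda>x. f x *\<^sub>R g x) absolutely_integrable_on {a..b}"
proof (rule absolutely_integrable_bounded_measurable_product[where h = "(*\<^sub>R)" and f = f])
  show "bilinear ((*\<^sub>R) :: real \<Rightarrow> 'a \<Rightarrow> 'a)"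
    by (simp add: bilinear_conv_bounded_bilinear bounded_bilinear_scaleR)
  show "f \<in> borel_measurable (lebesgue_on {a..b})"
    by (rule continuous_imp_measurable_on_sets_lebesgue[OF assms(1)]) simp
  show "bounded (f ` {a..b})"
    by (rule compact_imp_bounded[OF compact_continuous_image[OF assms(1)]]) simp
qed (use assms(2) in auto)

text \<open>The shift \<open>d\<close> allows one-sided kernels, so that \<open>c\<close> may be an endpoint of the interval.\<close>

lemma approximate_identity_tendsto:
  fixes w :: "real \<Rightarrow> complex"
  assumes w: "continuous_on {-1..1} w" and c: "c \<in> {-1..1}"
    and K: "continuous_on UNIV K" "\<And>x. 0 \<le> K x" "\<And>x. x \<le> 0 \<or> 1 \<le> x \<Longrightarrow> K x = 0"
    and H: "\<And>x. (H has_real_derivative K x) (at x)"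
    and mass: "\<forall>\<^sub>F n in sequentially. H (real n * (1 - c) + d) - H (real n * (-1 - c) + d) = 1"
  shows "(\<lambda>n. integral {-1..1} (\<lambda>t. (real n * K (real n * (t - c) + d)) *\<^sub>R w t)) \<longlonglongrightarrow> w c"
proof (rule LIMSEQ_I)
  fix e :: real
  assume "e > 0"
  obtain \<delta> where \<delta>: "\<delta> > 0" "\<And>t. t \<in> {-1..1} \<Longrightarrow> dist t c < \<delta> \<Longrightarrow> dist (w t) (w c) < e / 2"
    using w c half_gt_zero[OF \<open>e > 0\<close>] unfolding continuous_on_iff by blast
  define k where "k = (\<lambda>n t. real n * K (real n * (t - c) + d))"
  \<comment> \<open>\<open>K\<close> vanishes outside the unit interval, so the kernel can be
    nonzero at \<open>t\<close> only if \<open>real n * (t - c)\<close> has modulus below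
    \<open>\<bar>d\<bar> + 1\<close>. Beyond this threshold every such \<open>t\<close> lies within
    \<open>\<delta>\<close> of \<open>c\<close>.\<close>
  have "\<forall>\<^sub>F n in sequentially. (\<bar>d\<bar> + 1) / \<delta> < real n"
    using eventually_gt_at_top[of "nat \<lceil>(\<bar>d\<bar> + 1) / \<delta>\<rceil>"]
    by eventually_elim linarith
  with mass have "\<forall>\<^sub>F n in sequentially. norm (integral {-1..1} (\<lambda>t. k n t *\<^sub>R w t) - w c) < e"
  proof eventually_elim
    case (elim n)
    have [continuous_intros]: "continuous_on S (k n)" for S
      unfolding k_def
      by (intro continuous_intros continuous_on_compose2[OF K(1)]) auto
    have "((\<lambda>t. H (real n * (t - c) + d)) has_real_derivative k n t) (at t)" for t
    proof -
      have "((\<lambda>t. real n * (t - c) + d) has_real_derivative real n) (at t)"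
        by (auto intro!: derivative_eq_intros)
      from DERIV_chain'[OF this H] show ?thesis
        by (simp add: k_def mult.commute)
    qed
    then have "(k n has_integral H (real n * (1 - c) + d) - H (real n * (-1 - c) + d)) {-1..1}"
      by (intro fundamental_theorem_of_calculus)
         (auto simp flip: has_real_derivative_iff_has_vector_derivative
           intro: has_field_derivative_at_within)
    then have k1: "(k n has_integral 1) {-1..1}"
      using elim by simp
    have near: "norm (w t - w c) \<le> e / 2" if t: "t \<in> {-1..1}" and "k n t \<noteq> 0" for t
    proof -
      have "\<not> (real n * (t - c) + d \<le> 0 \<or> 1 \<le> real n * (t - c) + d)"
        using K(3)[of "real n * (t - c) + d"] that(2) unfolding k_def by auto
      then have "\<bar>real n * (t - c)\<bar> < \<bar>d\<bar> + 1"
        by linarith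
      also have "\<dots> < real n * \<delta>"
        using elim(2) \<delta>(1) by (simp add: field_simps)
      finally have "real n * \<bar>t - c\<bar> < real n * \<delta>"
        by (simp add: abs_mult)
      then have "\<bar>t - c\<bar> < \<delta>"
        by (rule mult_left_less_imp_less) simp
      then show ?thesis
        using \<delta>(2)[OF t] by (simp add: dist_norm)
    qed
    have "integral {-1..1} (\<lambda>t. k n t *\<^sub>R w t) - w c =
        integral {-1..1} (\<lambda>t. k n t *\<^sub>R w t) - integral {-1..1} (\<lambda>t. k n t *\<^sub>R w c)"
      using has_integral_scaleR_left[OF k1, of "w c"] by (simp add: integral_unique)
    also have "\<dots> = integral {-1..1} (\<lambda>t. k n t *\<^sub>R w t - k n t *\<^sub>R w c)"
      by (intro integral_diff[symmetric] integrable_continuous_interval continuous_intros w)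
    also have "norm \<dots> \<le> integral {-1..1} (\<lambda>t. k n t * (e / 2))"
    proof (intro integral_norm_bound_integral integrable_continuous_interval continuous_intros w)
      fix t :: real
      assume t: "t \<in> {-1..1}"
      have "norm (k n t *\<^sub>R w t - k n t *\<^sub>R w c) = k n t * norm (w t - w c)"
        using K(2) by (simp add: k_def flip: scaleR_right_diff_distrib)
      also have "\<dots> \<le> k n t * (e / 2)"
        using near[OF t] K(2) by (cases "k n t = 0") (auto simp: k_def intro!: mult_left_mono)
      finally show "norm (k n t *\<^sub>R w t - k n t *\<^sub>R w c) \<le> k n t * (e / 2)" .
    qed
    also have "\<dots> = e / 2"
      using integral_unique[OF k1] by simp
    finally show ?case
      using \<open>e > 0\<close> by simp
  qed
  then show "\<exists>no. \<forall>n\<ge>no. norm (integral {-1..1} (\<lambda>t. (real n * K (real n * (t - c) + d)) *\<^sub>R w t) - w c) < e"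
    unfolding k_def eventually_sequentially .
qed

text \<open>These are the test functions on which the weak identity is actually used. Multiplication
  by a member of \<open>smooth_fn\<close> preserves the class by construction, which gives the
  product rule for weak derivatives.\<close>

definition bump :: "(real \<Rightarrow> real) \<Rightarrow> bool" where
  "bump \<phi> \<longleftrightarrow> smooth_fn \<phi> \<and> (\<exists>a b. -1 < a \<and> b < 1 \<and> (\<forall>x. x \<notin> {a..b} \<longrightarrow> \<phi> x = 0))"

lemma bump_imp_test_function: "bump \<phi> \<Longrightarrow> test_function \<phi>"
  unfolding bump_def by (elim exE conjE) (rule smooth_fn_imp_test_function; blast)

lemma bump_mult: "bump \<phi> \<Longrightarrow> smooth_fn \<psi> \<Longrightarrow> bump (\<lambda>x. \<phi> x * \<psi> x)"
  unfolding bump_def using smooth_fn.mult[of \<phi> \<psi>] by auto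

text \<open>The weak identity is tested with smooth approximations of the indicator of the interval.
  Their derivatives are approximate identities at \<open>a\<close> minus those at \<open>b\<close>,
  so the left side tends to \<open>w a - w b\<close>, while dominated convergence with majorant
  \<open>norm (h t)\<close> handles the right side.\<close>

proposition weak_fundamental_theorem:
  fixes w h :: "real \<Rightarrow> complex"
  assumes w: "continuous_on {-1..1} w" and h: "h absolutely_integrable_on {-1..1}"
    and weak: "\<And>\<phi>. bump \<phi> \<Longrightarrow> integral {-1..1} (\<lambda>x. deriv \<phi> x *\<^sub>R w x) =
                 - integral {-1..1} (\<lambda>x. \<phi> x *\<^sub>R h x)"
    and ab: "-1 \<le> a" "a < b" "b \<le> 1"
  shows "integral {a..b} h = w b - w a"
proof -
  obtain H K where H: "smooth_fn H" "\<And>x. (H has_real_derivative K x) (at x)"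
      "\<And>x. x \<le> 0 \<Longrightarrow> H x = 0" "\<And>x. x \<ge> 1 \<Longrightarrow> H x = 1" "\<And>x. 0 \<le> H x" "\<And>x. H x \<le> 1"
    and K: "smooth_fn K" "\<And>x. 0 \<le> K x" "\<And>x. x \<le> 0 \<or> 1 \<le> x \<Longrightarrow> K x = 0"
    using smooth_step_exists by metis
  \<comment> \<open>The shifts -1 and 2 place the rise between \<open>a + 1 / n\<close> and
    \<open>a + 2 / n\<close> and the fall between \<open>b - 2 / n\<close> and
    \<open>b - 1 / n\<close>. The support thus stays inside the open interval even when
    \<open>a = -1\<close> or \<open>b = 1\<close>.\<close>
  define \<phi> where "\<phi> = (\<lambda>n t. H (real n * (t - a) + (-1)) - H (real n * (t - b) + 2))"
  have aff: "smooth_fn (\<lambda>t. F (real n * (t - c) + d))" if "smooth_fn F" for F n c d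
    using smooth_fn.affine[OF that, of "real n" "d - real n * c"] by (simp add: algebra_simps)
  have smooth: "smooth_fn (\<phi> n)" for n
    unfolding \<phi>_def by (intro smooth_fn_diff aff H)
  have chain: "((\<lambda>t. H (real n * (t - c) + d)) has_real_derivative
      real n * K (real n * (t - c) + d)) (at t)" for n c d t
  proof -
    have "((\<lambda>t. real n * (t - c) + d) has_real_derivative real n) (at t)"
      by (auto intro!: derivative_eq_intros)
    from DERIV_chain'[OF this H(2)] show ?thesis by (simp add: mult.commute)
  qed
  have deriv: "deriv (\<phi> n) t = real n * K (real n * (t - a) + (-1)) -
      real n * K (real n * (t - b) + 2)" for n t
    unfolding \<phi>_def by (intro DERIV_imp_deriv DERIV_diff chain)
  \<comment> \<open>The threshold 3 is what makes the second step vanish left of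
    \<open>a + 1 / n\<close> and the first step equal 1 right of \<open>b - 1 / n\<close>, so that
    the difference is 0 on both sides.\<close>
  obtain N where "3 < real N * (b - a)"
    using reals_Archimedean3[of "b - a"] ab by auto
  then have N: "3 \<le> real N * (b - a)"
    by simp
  have large: "3 \<le> real n * (b - a)" if "n \<ge> N" for n
    by (rule order_trans[OF N mult_right_mono]) (use that ab in auto)
  have bump: "bump (\<phi> n)" if n: "n \<ge> N" for n
    unfolding bump_def
  proof (intro conjI exI allI impI)
    have "n > 0"
      using large[OF n] by (cases n) auto
    then have "0 < 1 / real n"
      by simp
    with ab show "-1 < a + 1 / real n" and "b - 1 / real n < 1"
      by linarith+
    fix x
    assume "x \<notin> {a + 1 / real n..b - 1 / real n}"
    then consider "real n * (x - a) < 1" | "real n * (x - b) > -1"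
      using \<open>n > 0\<close> by (auto simp: field_simps not_le)
    then show "\<phi> n x = 0"
      using large[OF n] H(3,4) by cases (auto simp: \<phi>_def algebra_simps)
  qed (rule smooth)
  have ev_large: "\<forall>\<^sub>F n in sequentially. real n * m \<ge> 3" if m: "m > 0" for m :: real
  proof -
    obtain N where "3 < real N * m"
      using reals_Archimedean3[OF m] by auto
    then have "3 \<le> real n * m" if "n \<ge> N" for n
      by (intro order_trans[OF less_imp_le mult_right_mono]) (use that m in auto)
    then show ?thesis
      unfolding eventually_sequentially by blast
  qed
  have "(\<lambda>n. integral {-1..1} (\<lambda>t. \<phi> n t *\<^sub>R h t)) \<longlonglongrightarrow>
      integral {-1..1} (\<lambda>t. if t \<in> {a<..<b} then h t else 0)"
  proof (rule dominated_convergence(2))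
    show "(\<lambda>t. \<phi> n t *\<^sub>R h t) integrable_on {-1..1}" for n
      using absolutely_integrable_scaleR_continuous[OF smooth_fn_continuous_on[OF smooth] h]
      by (simp add: absolutely_integrable_on_def)
    show "(\<lambda>t. norm (h t)) integrable_on {-1..1}"
      using h by (simp add: absolutely_integrable_on_def)
    show "norm (\<phi> n t *\<^sub>R h t) \<le> norm (h t)" for n t
    proof -
      have "\<bar>\<phi> n t\<bar> \<le> 1"
        using H(5,6)[of "real n * (t - a) + (-1)"] H(5,6)[of "real n * (t - b) + 2"]
        unfolding \<phi>_def by linarith
      then show ?thesis
        by (simp add: mult_left_le_one_le)
    qed
    fix t :: real
    consider "t \<le> a" | "a < t" "t < b" | "t \<ge> b"
      by linarith
    then have "\<forall>\<^sub>F n in sequentially. (if t \<in> {a<..<b} then h t else 0) = \<phi> n t *\<^sub>R h t"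
    proof cases
      case 1
      from ev_large[of "b - a"] ab have "\<forall>\<^sub>F n in sequentially. 3 \<le> real n * (b - a)" by simp
      then show ?thesis
      proof eventually_elim
        case (elim n)
        moreover have "real n * (t - a) \<le> 0"
          using 1 by (simp add: mult_nonneg_nonpos)
        ultimately have "real n * (t - b) + 2 \<le> 0"
          by (simp add: algebra_simps)
        then show ?case
          using 1 H(3) \<open>real n * (t - a) \<le> 0\<close> by (simp add: \<phi>_def)
      qed
    next
      case 2
      from ev_large[of "t - a"] ev_large[of "b - t"] 2
      have "\<forall>\<^sub>F n in sequentially. 3 \<le> real n * (t - a)" "\<forall>\<^sub>F n in sequentially. 3 \<le> real n * (b - t)"
        by simp_all
      then show ?thesis
      proof eventually_elim
        case (elim n)
        then have "real n * (t - b) + 2 \<le> 0" "real n * (t - a) + (-1) \<ge> 1"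
          by (simp_all add: algebra_simps)
        then show ?case
          using 2 H(3,4) by (simp add: \<phi>_def)
      qed
    next
      case 3
      from ev_large[of "b - a"] ab have "\<forall>\<^sub>F n in sequentially. 3 \<le> real n * (b - a)" by simp
      then show ?thesis
      proof eventually_elim
        case (elim n)
        moreover have "real n * (t - b) \<ge> 0"
          using 3 by simp
        ultimately have "real n * (t - a) + (-1) \<ge> 1"
          by (simp add: algebra_simps)
        then show ?case
          using 3 H(4) \<open>real n * (t - b) \<ge> 0\<close> by (simp add: \<phi>_def)
      qed
    qed
    then show "(\<lambda>n. \<phi> n t *\<^sub>R h t) \<longlonglongrightarrow> (if t \<in> {a<..<b} then h t else 0)"
      by (rule Lim_transform_eventually[OF tendsto_const])
  qed
  also have "integral {-1..1} (\<lambda>t. if t \<in> {a<..<b} then h t else 0) = integral {a<..<b} h"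
  proof -
    have "{-1..1} \<inter> {a<..<b} = {a<..<b}"
      using ab by auto
    then show ?thesis
      using Henstock_Kurzweil_Integration.integral_restrict_Int[of "{-1..1}" "{a<..<b}" h] by (simp add: Int_commute)
  qed
  also have "\<dots> = integral {a..b} h"
    by (simp add: integral_open_interval_real)
  finally have lim_h: "(\<lambda>n. integral {-1..1} (\<lambda>t. \<phi> n t *\<^sub>R h t)) \<longlonglongrightarrow> integral {a..b} h" .
  have lim_a: "(\<lambda>n. integral {-1..1} (\<lambda>t. (real n * K (real n * (t - a) + (-1))) *\<^sub>R w t)) \<longlonglongrightarrow> w a"
  proof (rule approximate_identity_tendsto[OF w])
    have "\<forall>\<^sub>F n in sequentially. 3 \<le> real n * (1 - a)"
      using ev_large[of "1 - a"] ab by simp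
    then show "\<forall>\<^sub>F n in sequentially. H (real n * (1 - a) + (-1)) - H (real n * (-1 - a) + (-1)) = 1"
    proof eventually_elim
      case (elim n)
      have "real n * (-1 - a) \<le> 0"
        using ab by (simp add: mult_nonneg_nonpos)
      then show ?case
        using elim H(3,4) by simp
    qed
  qed (use ab K(2,3) H(2) smooth_fn_continuous_on[OF K(1)] in auto)
  have lim_b: "(\<lambda>n. integral {-1..1} (\<lambda>t. (real n * K (real n * (t - b) + 2)) *\<^sub>R w t)) \<longlonglongrightarrow> w b"
  proof (rule approximate_identity_tendsto[OF w])
    have "\<forall>\<^sub>F n in sequentially. 3 \<le> real n * (b - (-1))"
      using ev_large[of "b - (-1)"] ab by simp
    then show "\<forall>\<^sub>F n in sequentially. H (real n * (1 - b) + 2) - H (real n * (-1 - b) + 2) = 1"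
    proof eventually_elim
      case (elim n)
      have "real n * (1 - b) \<ge> 0"
        using ab by simp
      moreover have "real n * (-1 - b) + 2 \<le> 0"
        using elim by (simp add: algebra_simps)
      ultimately show ?case
        using H(3,4) by simp
    qed
  qed (use ab K(2,3) H(2) smooth_fn_continuous_on[OF K(1)] in auto)
  have int: "(\<lambda>t. (real n * K (real n * (t - c) + d)) *\<^sub>R w t) integrable_on {-1..1}" for n c d
  proof -
    have "continuous_on {-1..1} (\<lambda>t. K (real n * (t - c) + d))"
      by (rule smooth_fn_continuous_on[OF aff[OF K(1)]])
    then show ?thesis
      by (intro integrable_continuous_interval continuous_intros w)
  qed
  have "\<forall>\<^sub>F n in sequentially. integral {-1..1} (\<lambda>t. (real n * K (real n * (t - b) + 2)) *\<^sub>R w t) -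
      integral {-1..1} (\<lambda>t. (real n * K (real n * (t - a) + (-1))) *\<^sub>R w t) =
      integral {-1..1} (\<lambda>t. \<phi> n t *\<^sub>R h t)"
    using eventually_ge_at_top[of N]
  proof eventually_elim
    case (elim n)
    let ?A = "\<lambda>t. (real n * K (real n * (t - a) + (-1))) *\<^sub>R w t"
    let ?B = "\<lambda>t. (real n * K (real n * (t - b) + 2)) *\<^sub>R w t"
    have "integral {-1..1} ?A - integral {-1..1} ?B = integral {-1..1} (\<lambda>t. ?A t - ?B t)"
      by (rule integral_diff[OF int int, symmetric])
    also have "(\<lambda>t. ?A t - ?B t) = (\<lambda>t. deriv (\<phi> n) t *\<^sub>R w t)"
      by (simp only: deriv scaleR_left_diff_distrib)
    also have "integral {-1..1} \<dots> = - integral {-1..1} (\<lambda>t. \<phi> n t *\<^sub>R h t)"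
      by (rule weak[OF bump[OF elim]])
    finally have "- (integral {-1..1} ?A - integral {-1..1} ?B) =
        - (- integral {-1..1} (\<lambda>t. \<phi> n t *\<^sub>R h t))"
      by (rule arg_cong)
    then show ?case
      by (simp only: minus_diff_eq minus_minus)
  qed
  from Lim_transform_eventually[OF tendsto_diff[OF lim_b lim_a] this]
  show ?thesis
    by (rule LIMSEQ_unique[OF lim_h])
qed

section \<open>The fundamental lemma of the calculus of variations\<close>

lemma sigma_finite_lebesgue: "sigma_finite_measure (lebesgue :: real measure)"
proof
  obtain A where "countable A" "A \<subseteq> sets lborel" "\<Union>A = space lborel"
      "\<forall>a\<in>A. emeasure lborel (a :: real set) \<noteq> \<infinity>"
    using lborel.sigma_finite_countable by blast
  then show "\<exists>A. countable A \<and> A \<subseteq> sets lebesgue \<and> \<Union>A = space lebesgue \<and>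
      (\<forall>a\<in>A. emeasure lebesgue (a :: real set) \<noteq> \<infinity>)"
    by (intro exI[of _ A]) (auto simp: sets_completionI_sets subset_iff)
qed

text \<open>The sets on which \<open>f\<close> integrates to 0 contain the intervals and are stable
  under countable disjoint unions and, as the total integral is 0, under complements. Hence they
  include all Borel sets, and all Lebesgue sets, which differ from Borel sets by null sets.\<close>

lemma AE_eq_0_if_interval_integrals_eq_0:
  fixes f :: "real \<Rightarrow> complex"
  assumes f: "integrable lebesgue f" and zero: "\<And>a b. a < b \<Longrightarrow> integral {a..b} f = 0"
    and total: "(LINT x|lebesgue. f x) = 0"
  shows "AE x in lebesgue. f x = 0"
proof -
  have abs: "f absolutely_integrable_on A" if "A \<in> sets lebesgue" for A
    using that f by (simp add: set_integrable_def integrable_mult_indicator)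
  have borel: "(LINT x:A|lebesgue. f x) = 0" if "A \<in> sets borel" for A :: "real set"
    using that
  proof (induction rule: borel_set_induct)
    case empty
    then show ?case
      by (simp add: set_lebesgue_integral_def)
  next
    case (interval a b)
    have "(LINT x:{a..b}|lebesgue. f x) = integral {a..b} f"
      by (intro set_lebesgue_integral_eq_integral(2) abs) simp
    also have "\<dots> = 0"
      using zero[of a b] interval by (cases "a = b") auto
    finally show ?case .
  next
    case (compl A)
      have A: "A \<in> sets lebesgue"
        using compl.hyps by (simp add: sets_completionI_sets)
      have "(LINT x:A \<union> (- A)|lebesgue. f x) =
          (LINT x:A|lebesgue. f x) + (LINT x:- A|lebesgue. f x)"
        by (intro set_integral_Un abs A) (use A in \<open>auto simp: Compl_in_sets_lebesgue\<close>)
      then show ?case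
        using compl.IH total by (simp add: set_lebesgue_integral_def)
    next
      case (union A)
      have A: "A i \<in> sets lebesgue" for i
        using union.hyps by (auto simp: sets_completionI_sets)
      have "(LINT x:(\<Union>i. A i)|lebesgue. f x) = (\<Sum>i. (LINT x:A i|lebesgue. f x))"
        using union.hyps(1) A
        by (intro lebesgue_integral_countable_add abs) (auto simp: disjoint_family_on_def)
      then show ?case
        using union.IH by simp
  qed
  have "(LINT x:A|lebesgue. f x) = 0" if A: "A \<in> sets lebesgue" for A
  proof -
    obtain B N where B: "B \<in> sets borel" "negligible N" "B \<union> N = A"
      using sets_lebesgue_almost_borel[OF A] .
    have "(LINT x:A|lebesgue. f x) = integral A f"
      by (rule set_lebesgue_integral_eq_integral(2)[OF abs[OF A]])
    also have "\<dots> = integral B f"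
      by (rule integral_spike_set) (use B in \<open>auto intro: negligible_subset[of N]\<close>)
    also have "\<dots> = (LINT x:B|lebesgue. f x)"
      using B(1) by (intro set_lebesgue_integral_eq_integral(2)[symmetric] abs)
        (simp add: sets_completionI_sets)
    finally show ?thesis
      using borel[OF B(1)] by simp
  qed
  then show ?thesis
    by (rule sigma_finite_measure.density_zero[OF sigma_finite_lebesgue f])
qed

text \<open>Orthogonality to all bumps says that the zero function has weak derivative
  \<open>f\<close>. The weak fundamental theorem then makes every interval integral of
  \<open>f\<close> vanish.\<close>

lemma fundamental_lemma_of_calculus_of_variations:
  fixes f :: "real \<Rightarrow> complex"
  assumes f: "f absolutely_integrable_on {-1..1}"
    and zero: "\<And>\<phi>. bump \<phi> \<Longrightarrow> integral {-1..1} (\<lambda>x. \<phi> x *\<^sub>R f x) = 0"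
  shows "\<exists>N. negligible N \<and> (\<forall>x\<in>{-1..1} - N. f x = 0)"
proof -
  have int0: "integral {a..b} f = 0" if "-1 \<le> a" "a < b" "b \<le> 1" for a b
    using weak_fundamental_theorem[of "\<lambda>_. 0" f a b] f zero that by simp
  define F where "F = (\<lambda>x. indicat_real {-1..1} x *\<^sub>R f x)"
  have F_int: "integral {a..b} F = 0" for a b
  proof -
    have "integral {a..b} F = integral {a..b} (\<lambda>x. if x \<in> {-1..1} then f x else 0)"
      by (intro integral_cong) (simp add: F_def indicator_def)
    also have "\<dots> = integral ({-1..1} \<inter> {a..b}) f"
      by (rule Henstock_Kurzweil_Integration.integral_restrict_Int)
    also have "{-1..1} \<inter> {a..b} = {max (-1) a..min 1 b}"
      by auto
    also have "integral \<dots> f = 0"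
      using int0[of "max (-1) a" "min 1 b"]
      by (cases "max (-1) a" "min 1 b" rule: linorder_cases) auto
    finally show ?thesis .
  qed
  have F: "integrable lebesgue F"
    using f unfolding F_def set_integrable_def .
  have "AE x in lebesgue. F x = 0"
  proof (rule AE_eq_0_if_interval_integrals_eq_0[OF F F_int])
    have "(LINT x|lebesgue. F x) = (LINT x:{-1..1}|lebesgue. f x)"
      by (simp add: F_def set_lebesgue_integral_def)
    also have "\<dots> = 0"
      using set_lebesgue_integral_eq_integral(2)[OF f] int0[of "-1" 1] by simp
    finally show "(LINT x|lebesgue. F x) = 0" .
  qed
  then obtain N where "negligible N" "{x. F x \<noteq> 0} \<subseteq> N"
    unfolding eventually_ae_filter_negligible by blast
  then show ?thesis
    by (intro exI[of _ N]) (auto simp: F_def subset_iff indicator_def)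
qed

section \<open>Integration by parts against weak derivatives\<close>

lemma L2_imp_absolutely_integrable:
  assumes "L2 f"
  shows "f absolutely_integrable_on {-1..1}"
proof -
  have "(\<lambda>x. (1 + (cmod (f x))\<^sup>2) :: real) absolutely_integrable_on Omega"
    using assms by (intro set_integral_add) (auto simp: L2_def)
  then have "set_integrable lebesgue Omega f"
  proof (rule set_integrable_bound)
    have "norm (f x) \<le> norm (1 + (cmod (f x))\<^sup>2)" for x
    proof -
      \<comment> \<open>On a bounded interval \<open>1 + (cmod (f x))\<^sup>2\<close> is an
        integrable majorant of \<open>cmod (f x)\<close>.\<close>
      have "0 \<le> (cmod (f x) - 1)\<^sup>2"
        by simp
      then have "2 * cmod (f x) \<le> 1 + (cmod (f x))\<^sup>2"
        by (simp add: power2_diff)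
      with norm_ge_zero[of "f x"] show ?thesis
        unfolding real_norm_def by linarith
    qed
    then show "AE x in lebesgue. x \<in> Omega \<longrightarrow> norm (f x) \<le> norm (1 + (cmod (f x))\<^sup>2)"
      by simp
  qed (use assms in \<open>auto simp: L2_def\<close>)
  then show ?thesis
    by (simp add: absolutely_integrable_on_Icc_iff_Ioo)
qed

text \<open>Bridge from the Lebesgue integrals over the open interval in the definitions to the
  gauge integrals over the closed one, in which the argument runs.\<close>

lemma set_lebesgue_integral_Omega:
  fixes f :: "real \<Rightarrow> 'a::euclidean_space"
  assumes "f absolutely_integrable_on {-1..1}"
  shows "(LINT x:Omega|lebesgue. f x) = integral {-1..1} f"
  using assms set_lebesgue_integral_eq_integral(2)[of Omega f]
  by (simp add: absolutely_integrable_on_Icc_iff_Ioo integral_open_interval_real)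

lemma has_weak_deriv_bump:
  assumes "has_weak_deriv u g" "continuous_on {-1..1} u" "L2 g" "bump \<phi>"
  shows "integral {-1..1} (\<lambda>x. deriv \<phi> x *\<^sub>R u x) = - integral {-1..1} (\<lambda>x. \<phi> x *\<^sub>R g x)"
proof -
  have \<phi>: "smooth_fn \<phi>"
    using assms(4) by (simp add: bump_def)
  have "(\<lambda>x. deriv \<phi> x *\<^sub>R u x) absolutely_integrable_on {-1..1}"
    by (intro absolutely_integrable_scaleR_continuous smooth_fn_continuous_on smooth_fn_deriv \<phi>
        absolutely_integrable_continuous_real assms(2))
  moreover have "(\<lambda>x. \<phi> x *\<^sub>R g x) absolutely_integrable_on {-1..1}"
    by (intro absolutely_integrable_scaleR_continuous smooth_fn_continuous_on \<phi>
        L2_imp_absolutely_integrable assms(3))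
  moreover have "(LINT x:Omega|lebesgue. deriv \<phi> x *\<^sub>R u x) = - (LINT x:Omega|lebesgue. \<phi> x *\<^sub>R g x)"
    using assms(1,4) by (auto simp: has_weak_deriv_def bump_imp_test_function)
  ultimately show ?thesis
    by (simp add: set_lebesgue_integral_Omega)
qed

text \<open>The product of \<open>\<psi>\<close> and \<open>u\<close> has weak derivative
  \<open>\<psi> g + \<psi>' u\<close>: a bump times \<open>\<psi>\<close> is again a bump and may be
  tested against \<open>u\<close>. The weak fundamental theorem applied to this product gives the
  boundary terms.\<close>

proposition weak_integration_by_parts:
  assumes u: "continuous_on {-1..1} u" and g: "L2 g" "has_weak_deriv u g"
    and \<psi>: "smooth_fn \<psi>" and ab: "-1 \<le> a" "a < b" "b \<le> 1"
  shows "integral {a..b} (\<lambda>x. \<psi> x *\<^sub>R g x) =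
    \<psi> b *\<^sub>R u b - \<psi> a *\<^sub>R u a - integral {a..b} (\<lambda>x. deriv \<psi> x *\<^sub>R u x)"
proof -
  have \<psi>': "smooth_fn (deriv \<psi>)"
    by (rule smooth_fn_deriv[OF \<psi>])
  have u_abs: "u absolutely_integrable_on {-1..1}"
    by (rule absolutely_integrable_continuous_real[OF u])
  have abs: "(\<lambda>x. f x *\<^sub>R g x) absolutely_integrable_on {-1..1}"
    "(\<lambda>x. f x *\<^sub>R u x) absolutely_integrable_on {-1..1}" if "smooth_fn f" for f
    by (rule absolutely_integrable_scaleR_continuous[OF smooth_fn_continuous_on[OF that]
          L2_imp_absolutely_integrable[OF g(1)]],
        rule absolutely_integrable_scaleR_continuous[OF smooth_fn_continuous_on[OF that] u_abs])
  have int: "(\<lambda>x. f x *\<^sub>R g x) integrable_on {-1..1}"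
    "(\<lambda>x. f x *\<^sub>R u x) integrable_on {-1..1}" if "smooth_fn f" for f
    using abs[OF that] by (simp_all add: absolutely_integrable_on_def)
  have "integral {a..b} (\<lambda>x. \<psi> x *\<^sub>R g x + deriv \<psi> x *\<^sub>R u x) = \<psi> b *\<^sub>R u b - \<psi> a *\<^sub>R u a"
  proof (rule weak_fundamental_theorem[OF _ _ _ ab])
    show "continuous_on {-1..1} (\<lambda>x. \<psi> x *\<^sub>R u x)"
      by (intro continuous_intros smooth_fn_continuous_on \<psi> u)
    show "(\<lambda>x. \<psi> x *\<^sub>R g x + deriv \<psi> x *\<^sub>R u x) absolutely_integrable_on {-1..1}"
      by (intro set_integral_add(1) abs \<psi> \<psi>')
    fix \<phi>
    assume bump: "bump \<phi>"
    then have \<phi>: "smooth_fn \<phi>"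
      by (simp add: bump_def)
    have \<phi>': "smooth_fn (deriv \<phi>)"
      by (rule smooth_fn_deriv[OF \<phi>])
    have deriv: "deriv (\<lambda>x. \<phi> x * \<psi> x) x = deriv \<phi> x * \<psi> x + \<phi> x * deriv \<psi> x" for x
      using DERIV_mult[OF smooth_fn_deriv(2)[OF \<phi>, of x] smooth_fn_deriv(2)[OF \<psi>, of x]]
      by (simp add: DERIV_imp_deriv mult.commute)
    have sm: "smooth_fn (\<lambda>x. deriv \<phi> x * \<psi> x)" "smooth_fn (\<lambda>x. \<phi> x * deriv \<psi> x)"
        "smooth_fn (\<lambda>x. \<phi> x * \<psi> x)"
      using \<phi> \<phi>' \<psi> \<psi>' by (auto intro: smooth_fn.mult)
    have "integral {-1..1} (\<lambda>x. (deriv \<phi> x * \<psi> x) *\<^sub>R u x) +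
        integral {-1..1} (\<lambda>x. (\<phi> x * deriv \<psi> x) *\<^sub>R u x) =
        integral {-1..1} (\<lambda>x. (deriv \<phi> x * \<psi> x) *\<^sub>R u x + (\<phi> x * deriv \<psi> x) *\<^sub>R u x)"
      by (rule integral_add[OF int(2)[OF sm(1)] int(2)[OF sm(2)], symmetric])
    also have "\<dots> = integral {-1..1} (\<lambda>x. deriv (\<lambda>x. \<phi> x * \<psi> x) x *\<^sub>R u x)"
      by (simp only: deriv scaleR_left_distrib)
    also have "\<dots> = - integral {-1..1} (\<lambda>x. (\<phi> x * \<psi> x) *\<^sub>R g x)"
      by (rule has_weak_deriv_bump[OF g(2) u g(1) bump_mult[OF bump \<psi>]])
    finally have eq: "integral {-1..1} (\<lambda>x. (deriv \<phi> x * \<psi> x) *\<^sub>R u x) =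
        - (integral {-1..1} (\<lambda>x. (\<phi> x * \<psi> x) *\<^sub>R g x) +
           integral {-1..1} (\<lambda>x. (\<phi> x * deriv \<psi> x) *\<^sub>R u x))"
      by (simp add: eq_diff_eq[symmetric])
    have "integral {-1..1} (\<lambda>x. (\<phi> x * \<psi> x) *\<^sub>R g x) +
          integral {-1..1} (\<lambda>x. (\<phi> x * deriv \<psi> x) *\<^sub>R u x) =
        integral {-1..1} (\<lambda>x. (\<phi> x * \<psi> x) *\<^sub>R g x + (\<phi> x * deriv \<psi> x) *\<^sub>R u x)"
      by (rule integral_add[OF int(1)[OF sm(3)] int(2)[OF sm(2)], symmetric])
    with eq show "integral {-1..1} (\<lambda>x. deriv \<phi> x *\<^sub>R \<psi> x *\<^sub>R u x) =
        - integral {-1..1} (\<lambda>x. \<phi> x *\<^sub>R (\<psi> x *\<^sub>R g x + deriv \<psi> x *\<^sub>R u x))"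
      by (simp add: scaleR_right_distrib)
  qed
  moreover have sub: "f integrable_on {a..b}" if "f integrable_on {-1..1}" for f :: "real \<Rightarrow> complex"
    by (rule integrable_subinterval_real[OF that]) (use ab in auto)
  have "integral {a..b} (\<lambda>x. \<psi> x *\<^sub>R g x + deriv \<psi> x *\<^sub>R u x) =
      integral {a..b} (\<lambda>x. \<psi> x *\<^sub>R g x) + integral {a..b} (\<lambda>x. deriv \<psi> x *\<^sub>R u x)"
    by (rule integral_add[OF sub[OF int(1)[OF \<psi>]] sub[OF int(2)[OF \<psi>']]])
  ultimately show ?thesis
    by (simp add: algebra_simps)
qed

lemma absolutely_integrable_mult_continuous:
  fixes f g :: "real \<Rightarrow> complex"
  assumes "continuous_on {a..b} f" "g absolutely_integrable_on {a..b}"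
  shows "(\<lambda>x. g x * f x) absolutely_integrable_on {a..b}"
proof -
  have "(\<lambda>x. f x * g x) absolutely_integrable_on {a..b}"
  proof (rule absolutely_integrable_bounded_measurable_product[where h = "(*)" and f = f])
    show "bilinear ((*) :: complex \<Rightarrow> complex \<Rightarrow> complex)"
      by (simp add: bilinear_conv_bounded_bilinear bounded_bilinear_mult)
    show "f \<in> borel_measurable (lebesgue_on {a..b})"
      by (rule continuous_imp_measurable_on_sets_lebesgue[OF assms(1)]) simp
    show "bounded (f ` {a..b})"
      by (rule compact_imp_bounded[OF compact_continuous_image[OF assms(1)]]) simp
  qed (use assms(2) in auto)
  then show ?thesis
    by (simp add: mult.commute)
qed

text \<open>Smoothness is a notion for real functions here, so the complex factor is split into real
  and imaginary parts and the two real identities are recombined.\<close>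

lemma weak_integration_by_parts_complex:
  assumes u: "continuous_on {-1..1} u" and g: "L2 g" "has_weak_deriv u g"
    and \<psi>: "smooth_fn (\<lambda>t. Re (\<psi> t))" "smooth_fn (\<lambda>t. Im (\<psi> t))"
    and deriv: "\<And>t. (\<psi> has_vector_derivative \<psi>' t) (at t)"
    and ab: "-1 \<le> a" "a < b" "b \<le> 1"
  shows "integral {a..b} (\<lambda>x. g x * \<psi> x) = u b * \<psi> b - u a * \<psi> a - integral {a..b} (\<lambda>x. u x * \<psi>' x)"
proof -
  have Re: "deriv (\<lambda>t. Re (\<psi> t)) = (\<lambda>t. Re (\<psi>' t))"
    using bounded_linear.has_vector_derivative[OF bounded_linear_Re deriv]
    by (intro ext DERIV_imp_deriv) (simp add: has_real_derivative_iff_has_vector_derivative)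
  have Im: "deriv (\<lambda>t. Im (\<psi> t)) = (\<lambda>t. Im (\<psi>' t))"
    using bounded_linear.has_vector_derivative[OF bounded_linear_Im deriv]
    by (intro ext DERIV_imp_deriv) (simp add: has_real_derivative_iff_has_vector_derivative)
  have split: "z * w = Re w *\<^sub>R z + \<i> * (Im w *\<^sub>R z)" for z w :: complex
    by (simp add: complex_eq_iff algebra_simps)
  have u_abs: "u absolutely_integrable_on {-1..1}"
    by (rule absolutely_integrable_continuous_real[OF u])
  have abs: "(\<lambda>x. f x *\<^sub>R g x) integrable_on {a..b}" "(\<lambda>x. f x *\<^sub>R u x) integrable_on {a..b}"
    if "smooth_fn f" for f
  proof -
    have "(\<lambda>x. f x *\<^sub>R h x) integrable_on {a..b}" if "h absolutely_integrable_on {-1..1}"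
      for h :: "real \<Rightarrow> complex"
    proof -
      have "(\<lambda>x. f x *\<^sub>R h x) absolutely_integrable_on {-1..1}"
        by (rule absolutely_integrable_scaleR_continuous[OF smooth_fn_continuous_on that]) fact
      then have "(\<lambda>x. f x *\<^sub>R h x) integrable_on {-1..1}"
        by (simp add: absolutely_integrable_on_def)
      then show ?thesis
        by (rule integrable_subinterval_real) (use ab in auto)
    qed
    then show "(\<lambda>x. f x *\<^sub>R g x) integrable_on {a..b}" "(\<lambda>x. f x *\<^sub>R u x) integrable_on {a..b}"
      using u_abs L2_imp_absolutely_integrable[OF g(1)] by blast+
  qed
  have combine: "integral {a..b} (\<lambda>x. h x * \<phi> x) =
      integral {a..b} (\<lambda>x. Re (\<phi> x) *\<^sub>R h x) + \<i> * integral {a..b} (\<lambda>x. Im (\<phi> x) *\<^sub>R h x)"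
    if "(\<lambda>x. Re (\<phi> x) *\<^sub>R h x) integrable_on {a..b}" "(\<lambda>x. Im (\<phi> x) *\<^sub>R h x) integrable_on {a..b}"
    for h \<phi> :: "real \<Rightarrow> complex"
  proof -
    have "integral {a..b} (\<lambda>x. h x * \<phi> x) =
        integral {a..b} (\<lambda>x. Re (\<phi> x) *\<^sub>R h x + \<i> * (Im (\<phi> x) *\<^sub>R h x))"
      by (subst split) (rule refl)
    also have "\<dots> = integral {a..b} (\<lambda>x. Re (\<phi> x) *\<^sub>R h x) +
        integral {a..b} (\<lambda>x. \<i> * (Im (\<phi> x) *\<^sub>R h x))"
      by (rule integral_add[OF that(1) integrable_on_mult_right[OF that(2)]])
    finally show ?thesis
      by (simp only: integral_mult_right)
  qed
  have "integral {a..b} (\<lambda>x. g x * \<psi> x) =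
      integral {a..b} (\<lambda>x. Re (\<psi> x) *\<^sub>R g x) + \<i> * integral {a..b} (\<lambda>x. Im (\<psi> x) *\<^sub>R g x)"
    by (intro combine abs \<psi>)
  also have "\<dots> = (Re (\<psi> b) *\<^sub>R u b - Re (\<psi> a) *\<^sub>R u a - integral {a..b} (\<lambda>x. Re (\<psi>' x) *\<^sub>R u x)) +
      \<i> * (Im (\<psi> b) *\<^sub>R u b - Im (\<psi> a) *\<^sub>R u a - integral {a..b} (\<lambda>x. Im (\<psi>' x) *\<^sub>R u x))"
    using weak_integration_by_parts[OF u g \<psi>(1) ab] weak_integration_by_parts[OF u g \<psi>(2) ab]
    unfolding Re Im by (simp only:)
  also have "\<dots> = u b * \<psi> b - u a * \<psi> a - (integral {a..b} (\<lambda>x. Re (\<psi>' x) *\<^sub>R u x) +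
      \<i> * integral {a..b} (\<lambda>x. Im (\<psi>' x) *\<^sub>R u x))"
    unfolding split[of _ "\<psi> a"] split[of _ "\<psi> b"] by (simp only: ring_distribs) algebra
  also have "integral {a..b} (\<lambda>x. Re (\<psi>' x) *\<^sub>R u x) + \<i> * integral {a..b} (\<lambda>x. Im (\<psi>' x) *\<^sub>R u x) =
      integral {a..b} (\<lambda>x. u x * \<psi>' x)"
    using abs(2)[OF smooth_fn_deriv(1)[OF \<psi>(1)]] abs(2)[OF smooth_fn_deriv(1)[OF \<psi>(2)]]
    unfolding Re Im by (intro combine[symmetric])
  finally show ?thesis .
qed

section \<open>Gluing, and continuously differentiable functions as elements of the Sobolev
  space\<close>

lemma continuously_differentiable_glue:
  fixes Y Y' :: "nat \<Rightarrow> real \<Rightarrow> complex"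
  assumes deriv: "\<And>j t. (Y j has_vector_derivative Y' j t) (at t)"
    and cont: "\<And>j. continuous_on UNIV (Y' j)"
    and incr: "\<And>j. j \<le> n \<Longrightarrow> x j < x (Suc j)"
    and match: "\<And>j. j < n \<Longrightarrow> Y (Suc j) (x (Suc j)) = Y (Suc (Suc j)) (x (Suc j))"
      "\<And>j. j < n \<Longrightarrow> Y' (Suc j) (x (Suc j)) = Y' (Suc (Suc j)) (x (Suc j))"
  shows "\<exists>Z Z'. (\<forall>t. (Z has_vector_derivative Z' t) (at t)) \<and> continuous_on UNIV Z' \<and>
    (\<forall>t\<ge>x n. Z t = Y (Suc n) t \<and> Z' t = Y' (Suc n) t) \<and>
    (\<forall>j<n. \<forall>t\<in>{x j..x (Suc j)}. Z t = Y (Suc j) t \<and> Z' t = Y' (Suc j) t)"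
  using incr match
proof (induction n)
  case 0
  show ?case
    by (intro exI[of _ "Y (Suc 0)"] exI[of _ "Y' (Suc 0)"]) (use deriv cont in auto)
next
  case (Suc n)
  let ?P = "\<lambda>Z Z'. (\<forall>t. (Z has_vector_derivative Z' t) (at t)) \<and> continuous_on UNIV Z' \<and>
      (\<forall>t\<ge>x n. Z t = Y (Suc n) t \<and> Z' t = Y' (Suc n) t) \<and>
      (\<forall>j<n. \<forall>t\<in>{x j..x (Suc j)}. Z t = Y (Suc j) t \<and> Z' t = Y' (Suc j) t)"
  have "\<exists>Z Z'. ?P Z Z'"
    by (rule Suc.IH) (simp_all add: Suc.prems)
  then obtain Z Z' where P: "?P Z Z'"
    by (elim exE)
  have Z: "\<And>t. (Z has_vector_derivative Z' t) (at t)" "continuous_on UNIV Z'"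
    and last: "\<forall>t\<ge>x n. Z t = Y (Suc n) t \<and> Z' t = Y' (Suc n) t"
    and layers: "\<forall>j<n. \<forall>t\<in>{x j..x (Suc j)}. Z t = Y (Suc j) t \<and> Z' t = Y' (Suc j) t"
    using P by simp_all
  let ?c = "x (Suc n)"
  have c: "x n < ?c"
    using Suc.prems(1)[of n] by simp
  have m: "Z ?c = Y (Suc (Suc n)) ?c" "Z' ?c = Y' (Suc (Suc n)) ?c"
    using last c Suc.prems(2,3)[of n] by auto
  \<comment> \<open>Only the last piece is cut, at the new node; the induction hypothesis keeps it
    on the whole ray right of \<open>x n\<close>, so it is still available there. Agreement of
    values and slopes at the cut makes the new function continuously differentiable.\<close>
  define W W' where "W = (\<lambda>t. if t \<in> {..?c} then Z t else Y (Suc (Suc n)) t)"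
    and "W' = (\<lambda>t. if t \<in> {..?c} then Z' t else Y' (Suc (Suc n)) t)"
  have "(W has_vector_derivative W' t) (at t)" for t
    unfolding W_def W'_def
    by (rule has_vector_derivative_If_within_closures[where T = "{?c..}" and S = "{..?c}"])
       (use m in \<open>auto intro: has_vector_derivative_at_within[OF Z(1)]
          has_vector_derivative_at_within[OF deriv]\<close>)
  moreover have "continuous_on UNIV W'"
  proof -
    have "continuous_on ({t. t \<le> ?c} \<union> {t. ?c \<le> t}) (\<lambda>t. if t \<le> ?c then Z' t else Y' (Suc (Suc n)) t)"
      by (rule continuous_on_cases)
         (use m in \<open>auto intro: continuous_on_subset[OF Z(2)] continuous_on_subset[OF cont]
            closed_Collect_le continuous_intros\<close>)
    moreover have "{t. t \<le> ?c} \<union> {t. ?c \<le> t} = UNIV"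
      by auto
    ultimately show ?thesis
      by (simp add: W'_def)
  qed
  moreover have "W t = Y (Suc (Suc n)) t \<and> W' t = Y' (Suc (Suc n)) t" if "t \<ge> ?c" for t
    using that m by (cases "t = ?c") (auto simp: W_def W'_def)
  moreover have "W t = Y (Suc j) t \<and> W' t = Y' (Suc j) t" if "j < Suc n" "t \<in> {x j..x (Suc j)}" for j t
  proof (cases "j = n")
    case True
    then show ?thesis
      using that last by (auto simp: W_def W'_def)
  next
    case False
    have "Suc j \<le> Suc n"
      using that by simp
    then have "x (Suc j) \<le> ?c"
      using Suc.prems(1)
    proof (induction rule: inc_induct)
      case (step i)
      then show ?case
        using step.prems[of i] by fastforce
    qed simp
    then show ?thesis
      using that False layers by (auto simp: W_def W'_def)
  qed
  ultimately show ?case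
    by blast
qed

lemma continuous_imp_L2:
  assumes "continuous_on {-1..1} f"
  shows "L2 f"
proof -
  have "f absolutely_integrable_on {-1..1}"
    by (rule absolutely_integrable_continuous_real[OF assms])
  then have "f absolutely_integrable_on Omega"
    by (simp add: absolutely_integrable_on_Icc_iff_Ioo)
  moreover have "(\<lambda>x. (cmod (f x))\<^sup>2) absolutely_integrable_on {-1..1}"
    by (intro absolutely_integrable_continuous_real continuous_intros assms)
  then have "(\<lambda>x. (cmod (f x))\<^sup>2) absolutely_integrable_on Omega"
    by (simp only: absolutely_integrable_on_Icc_iff_Ioo)
  ultimately show ?thesis
    unfolding L2_def set_borel_measurable_def
    by (intro conjI borel_measurable_integrable) (simp_all add: set_integrable_def)
qed

text \<open>The product rule and the fundamental theorem apply classically, and the boundary terms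
  vanish because the support of a test function lies in the open interval.\<close>

lemma has_weak_deriv_if_continuously_differentiable:
  assumes deriv: "\<And>t. (z has_vector_derivative z' t) (at t)" and cont: "continuous_on UNIV z'"
  shows "has_weak_deriv z z'"
  unfolding has_weak_deriv_def
proof (intro allI impI)
  fix \<phi>
  assume \<phi>: "test_function \<phi>"
  then have diff: "\<phi> differentiable_on UNIV" "deriv \<phi> differentiable_on UNIV"
    unfolding test_function_def by (metis funpow_0, metis funpow_0 funpow_simps_right(2) comp_apply)
  have D: "(\<phi> has_real_derivative deriv \<phi> t) (at t)" for t
    using diff(1) by (simp add: differentiable_on_def DERIV_deriv_iff_real_differentiable)
  have c: "continuous_on S \<phi>" "continuous_on S (deriv \<phi>)" for S
    by (rule continuous_on_subset[OF differentiable_imp_continuous_on[OF diff(1)]], simp)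
       (rule continuous_on_subset[OF differentiable_imp_continuous_on[OF diff(2)]], simp)
  have zc: "continuous_on S z" "continuous_on S z'" for S
    by (intro continuous_at_imp_continuous_on ballI has_vector_derivative_continuous[OF deriv])
       (rule continuous_on_subset[OF cont], simp)
  have "\<phi> t = 0" if "t \<notin> Omega" for t
    using \<phi> that closure_subset[of "{x. \<phi> x \<noteq> 0}"] unfolding test_function_def by blast
  then have ends: "\<phi> 1 = 0" "\<phi> (-1) = 0"
    by auto
  have int: "(\<lambda>x. deriv \<phi> x *\<^sub>R z x) absolutely_integrable_on {-1..1}"
    "(\<lambda>x. \<phi> x *\<^sub>R z' x) absolutely_integrable_on {-1..1}"
    by (rule absolutely_integrable_continuous_real[OF continuous_on_scaleR[OF c(2) zc(1)]])
       (rule absolutely_integrable_continuous_real[OF continuous_on_scaleR[OF c(1) zc(2)]])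
  have "((\<lambda>x. \<phi> x *\<^sub>R z' x + deriv \<phi> x *\<^sub>R z x) has_integral \<phi> 1 *\<^sub>R z 1 - \<phi> (-1) *\<^sub>R z (-1)) {-1..1}"
    by (rule fundamental_theorem_of_calculus)
       (simp, rule has_vector_derivative_at_within[OF has_vector_derivative_scaleR[OF D deriv]])
  then have "integral {-1..1} (\<lambda>x. \<phi> x *\<^sub>R z' x + deriv \<phi> x *\<^sub>R z x) = 0"
    by (simp add: ends integral_unique)
  moreover have "integral {-1..1} (\<lambda>x. \<phi> x *\<^sub>R z' x + deriv \<phi> x *\<^sub>R z x) =
      integral {-1..1} (\<lambda>x. \<phi> x *\<^sub>R z' x) + integral {-1..1} (\<lambda>x. deriv \<phi> x *\<^sub>R z x)"
    using int by (intro integral_add) (simp_all add: absolutely_integrable_on_def)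
  ultimately show "(LINT x:Omega|lebesgue. deriv \<phi> x *\<^sub>R z x) = - (LINT x:Omega|lebesgue. \<phi> x *\<^sub>R z' x)"
    by (simp add: set_lebesgue_integral_Omega int eq_neg_iff_add_eq_0 add.commute)
qed

lemma weak_deriv_H1:
  assumes "H1 u"
  shows "L2 (weak_deriv u)" "has_weak_deriv u (weak_deriv u)"
proof -
  have "\<exists>g. L2 g \<and> has_weak_deriv u g"
    using assms by (simp add: H1_def)
  then have "L2 (weak_deriv u) \<and> has_weak_deriv u (weak_deriv u)"
    unfolding weak_deriv_def by (rule someI_ex)
  then show "L2 (weak_deriv u)" "has_weak_deriv u (weak_deriv u)"
    by auto
qed

text \<open>Two weak derivatives have the same integral against every bump, so the fundamental lemma
  applies to their difference. This is how the arbitrary choice in \<open>weak_deriv\<close> is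
  identified with a derivative computed by hand.\<close>

lemma weak_deriv_unique:
  assumes u: "continuous_on {-1..1} u" and g: "L2 g" "has_weak_deriv u g" and h: "L2 h" "has_weak_deriv u h"
  shows "\<exists>N. negligible N \<and> (\<forall>x\<in>{-1..1} - N. g x = h x)"
proof -
  have abs: "g absolutely_integrable_on {-1..1}" "h absolutely_integrable_on {-1..1}"
    using g(1) h(1) by (simp_all add: L2_imp_absolutely_integrable)
  have "\<exists>N. negligible N \<and> (\<forall>x\<in>{-1..1} - N. g x - h x = 0)"
  proof (rule fundamental_lemma_of_calculus_of_variations)
    show "(\<lambda>x. g x - h x) absolutely_integrable_on {-1..1}"
      by (intro set_integral_diff(1) abs)
    fix \<phi>
    assume \<phi>: "bump \<phi>"
    have int: "(\<lambda>x. \<phi> x *\<^sub>R f x) integrable_on {-1..1}" if "f absolutely_integrable_on {-1..1}"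
      for f :: "real \<Rightarrow> complex"
    proof -
      have "(\<lambda>x. \<phi> x *\<^sub>R f x) absolutely_integrable_on {-1..1}"
        using \<phi> that unfolding bump_def
        by (intro absolutely_integrable_scaleR_continuous smooth_fn_continuous_on) auto
      then show ?thesis
        by (simp add: absolutely_integrable_on_def)
    qed
    have "integral {-1..1} (\<lambda>x. \<phi> x *\<^sub>R g x - \<phi> x *\<^sub>R h x) =
        integral {-1..1} (\<lambda>x. \<phi> x *\<^sub>R g x) - integral {-1..1} (\<lambda>x. \<phi> x *\<^sub>R h x)"
      by (rule integral_diff[OF int[OF abs(1)] int[OF abs(2)]])
    also have "\<dots> = 0"
      using has_weak_deriv_bump[OF g(2) u g(1) \<phi>] has_weak_deriv_bump[OF h(2) u h(1) \<phi>] by simp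
    finally show "integral {-1..1} (\<lambda>x. \<phi> x *\<^sub>R (g x - h x)) = 0"
      by (simp add: scaleR_diff_right)
  qed
  then show ?thesis
    by simp
qed

lemma continuously_differentiable_imp_H1:
  assumes deriv: "\<And>t. (z has_vector_derivative z' t) (at t)" and cont: "continuous_on UNIV z'"
  shows "H1 z" "\<exists>N. negligible N \<and> (\<forall>x\<in>{-1..1} - N. weak_deriv z x = z' x)"
proof -
  have z: "continuous_on {-1..1} z"
    by (intro continuous_at_imp_continuous_on ballI has_vector_derivative_continuous[OF deriv])
  have weak: "L2 z'" "has_weak_deriv z z'"
    by (rule continuous_imp_L2[OF continuous_on_subset[OF cont]], simp)
       (rule has_weak_deriv_if_continuously_differentiable[OF assms])
  show "H1 z"
    unfolding H1_def using z weak continuous_imp_L2 by blast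
  then show "\<exists>N. negligible N \<and> (\<forall>x\<in>{-1..1} - N. weak_deriv z x = z' x)"
    by (intro weak_deriv_unique[OF z] weak weak_deriv_H1)
qed

lemma absolutely_integrable_layers:
  fixes f :: "real \<Rightarrow> 'a::euclidean_space"
  assumes "\<And>j. j < n \<Longrightarrow> x j \<le> x (Suc j)" "\<And>j. j < n \<Longrightarrow> f absolutely_integrable_on {x j..x (Suc j)}"
  shows "f absolutely_integrable_on {x 0..x n}"
    "integral {x 0..x n} f = (\<Sum>j<n. integral {x j..x (Suc j)} f)"
proof -
  have "f absolutely_integrable_on {x 0..x n} \<and>
    integral {x 0..x n} f = (\<Sum>j<n. integral {x j..x (Suc j)} f) \<and> x 0 \<le> x n"
    using assms
  proof (induction n)
    case 0
    show ?case
      using integrable_on_refl[of f "x 0"] integrable_on_refl[of "\<lambda>t. norm (f t)" "x 0"]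
      by (simp add: absolutely_integrable_on_def)
  next
    case (Suc n)
    have IH: "f absolutely_integrable_on {x 0..x n}" "x 0 \<le> x n"
        "integral {x 0..x n} f = (\<Sum>j<n. integral {x j..x (Suc j)} f)"
      using Suc.IH Suc.prems by auto
    have step: "f absolutely_integrable_on {x n..x (Suc n)}" "x n \<le> x (Suc n)"
      using Suc.prems by auto
    have "f absolutely_integrable_on {x 0..x (Suc n)}"
      using IH(1) step(1) unfolding absolutely_integrable_on_def
      by (auto intro: Henstock_Kurzweil_Integration.integrable_combine[OF IH(2) step(2)])
    moreover from this have "integral {x 0..x (Suc n)} f =
        integral {x 0..x n} f + integral {x n..x (Suc n)} f"
      unfolding absolutely_integrable_on_def
      by (intro Henstock_Kurzweil_Integration.integral_combine[OF IH(2) step(2), symmetric]) auto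
    ultimately show ?case
      using IH step by auto
  qed
  then show "f absolutely_integrable_on {x 0..x n}"
    "integral {x 0..x n} f = (\<Sum>j<n. integral {x j..x (Suc j)} f)"
    by auto
qed

section \<open>Layered media\<close>

text \<open>There are \<open>n + 1\<close> layers, and layer \<open>Suc j\<close> lies between
  \<open>x j\<close> and \<open>x (Suc j)\<close>. Inside the layers and at the two outer endpoints,
  which enter the impedance terms, the speed is recorded only through the wavenumbers
  \<open>w\<close>; at interior nodes nothing is fixed.\<close>

locale layered_medium =
  fixes x w :: "nat \<Rightarrow> real" and n :: nat and \<omega> :: real and cs :: "real \<Rightarrow> real"
  assumes first: "x 0 = -1" and last: "x (Suc n) = 1"
    and incr: "j \<le> n \<Longrightarrow> x j < x (Suc j)"
    and wavenumber: "j \<le> n \<Longrightarrow> t \<in> {x j<..<x (Suc j)} \<Longrightarrow> \<omega> / cs t = w (Suc j)"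
    and wavenumber_first: "\<omega> / cs (-1) = w 1"
    and wavenumber_last: "\<omega> / cs 1 = w (Suc n)"
begin

lemma node_mono: "i \<le> j \<Longrightarrow> j \<le> Suc n \<Longrightarrow> x i \<le> x j"
proof (induction j rule: dec_induct)
  case (step j)
  then show ?case
    using incr[of j] by simp
qed simp

lemma layer_subset: "j \<le> n \<Longrightarrow> {x j..x (Suc j)} \<subseteq> {-1..1}"
  using node_mono[of 0 j] node_mono[of "Suc j" "Suc n"] first last by auto

lemma sum_layers:
  fixes f :: "real \<Rightarrow> 'a::euclidean_space"
  assumes "\<And>j. j \<le> n \<Longrightarrow> f absolutely_integrable_on {x j..x (Suc j)}"
  shows "f absolutely_integrable_on {-1..1}"
    "integral {-1..1} f = (\<Sum>j<Suc n. integral {x j..x (Suc j)} f)"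
  using absolutely_integrable_layers[of "Suc n" x f] assms incr first last
  by (auto simp: less_Suc_eq_le less_imp_le simp del: sum.lessThan_Suc)

text \<open>The energy density is nonnegative, so one may keep a single layer and drop the gradient
  term there.\<close>

lemma energy_norm_layer:
  assumes u: "H1 u" and m: "m \<le> n"
  shows "(w (Suc m))\<^sup>2 * integral {x m..x (Suc m)} (\<lambda>t. (cmod (u t))\<^sup>2) \<le> (energy_norm \<omega> cs u)\<^sup>2"
proof -
  define g where "g = weak_deriv u"
  define e where "e = (\<lambda>t. (cmod (g t))\<^sup>2 + (\<omega> / cs t)\<^sup>2 * (cmod (u t))\<^sup>2)"
  have "set_integrable lebesgue Omega (\<lambda>t. (cmod (g t))\<^sup>2)"
    using weak_deriv_H1(1)[OF u] by (simp add: g_def L2_def)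
  then have g: "(\<lambda>t. (cmod (g t))\<^sup>2) absolutely_integrable_on {-1..1}"
    by (simp only: absolutely_integrable_on_Icc_iff_Ioo)
  have u_cont: "continuous_on {-1..1} u"
    using u by (simp add: H1_def)
  have layer: "e absolutely_integrable_on {x j..x (Suc j)}"
    "(w (Suc j))\<^sup>2 * integral {x j..x (Suc j)} (\<lambda>t. (cmod (u t))\<^sup>2) \<le> integral {x j..x (Suc j)} e"
    if j: "j \<le> n" for j
  proof -
    have u_abs: "(\<lambda>t. (w (Suc j))\<^sup>2 * (cmod (u t))\<^sup>2) absolutely_integrable_on {x j..x (Suc j)}"
      by (intro absolutely_integrable_continuous_real continuous_intros
          continuous_on_subset[OF u_cont layer_subset[OF j]])
    have "(\<lambda>t. (cmod (g t))\<^sup>2) absolutely_integrable_on {x j..x (Suc j)}"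
      using layer_subset[OF j] by (intro absolutely_integrable_on_subinterval[OF g])
    then have sum: "(\<lambda>t. (cmod (g t))\<^sup>2 + (w (Suc j))\<^sup>2 * (cmod (u t))\<^sup>2)
        absolutely_integrable_on {x j..x (Suc j)}"
      using u_abs by (rule set_integral_add(1))
    \<comment> \<open>The nodes are left out because the speed is arbitrary there.\<close>
    have eq: "e t = (cmod (g t))\<^sup>2 + (w (Suc j))\<^sup>2 * (cmod (u t))\<^sup>2"
      if "t \<in> {x j..x (Suc j)} - {x j, x (Suc j)}" for t
      using wavenumber[OF j, of t] that by (simp add: e_def)
    have null: "negligible {x j, x (Suc j)}"
      by simp
    show "e absolutely_integrable_on {x j..x (Suc j)}"
      by (rule absolutely_integrable_spike[OF sum null eq])
    have "(w (Suc j))\<^sup>2 * integral {x j..x (Suc j)} (\<lambda>t. (cmod (u t))\<^sup>2) =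
        integral {x j..x (Suc j)} (\<lambda>t. (w (Suc j))\<^sup>2 * (cmod (u t))\<^sup>2)"
      by (rule integral_mult_right[symmetric])
    also have "\<dots> \<le> integral {x j..x (Suc j)} (\<lambda>t. (cmod (g t))\<^sup>2 + (w (Suc j))\<^sup>2 * (cmod (u t))\<^sup>2)"
      using u_abs sum by (intro integral_le) (simp_all add: absolutely_integrable_on_def)
    also have "\<dots> = integral {x j..x (Suc j)} e"
      by (rule integral_spike[OF null eq])
    finally show "(w (Suc j))\<^sup>2 * integral {x j..x (Suc j)} (\<lambda>t. (cmod (u t))\<^sup>2) \<le>
        integral {x j..x (Suc j)} e" .
  qed
  have nonneg: "0 \<le> integral {x j..x (Suc j)} e" if "j \<le> n" for j
  proof (rule Henstock_Kurzweil_Integration.integral_nonneg)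
    show "e integrable_on {x j..x (Suc j)}"
      using layer(1)[OF that] by (simp add: absolutely_integrable_on_def)
  qed (simp add: e_def)
  have "(w (Suc m))\<^sup>2 * integral {x m..x (Suc m)} (\<lambda>t. (cmod (u t))\<^sup>2) \<le> integral {x m..x (Suc m)} e"
    by (rule layer(2)[OF m])
  also have "\<dots> \<le> (\<Sum>j<Suc n. integral {x j..x (Suc j)} e)"
    by (rule member_le_sum) (use m nonneg in auto)
  also have "\<dots> = integral {-1..1} e"
    by (rule sum_layers(2)[OF layer(1), symmetric])
  also have "\<dots> = (LINT t:Omega|lebesgue. e t)"
    by (rule set_lebesgue_integral_Omega[OF sum_layers(1)[OF layer(1)], symmetric])
  also have "\<dots> = (energy_norm \<omega> cs u)\<^sup>2"
  proof -
    \<comment> \<open>Nonnegativity is what allows the square root in the energy norm to be squared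
      back to the integral.\<close>
    have "0 \<le> (LINT t:Omega|lebesgue. e t)"
      unfolding set_lebesgue_integral_def by (rule integral_nonneg_AE) (simp add: e_def)
    then show ?thesis
      by (simp add: energy_norm_def e_def g_def)
  qed
  finally show ?thesis .
qed

text \<open>The test function \<open>z\<close> is the conjugate of \<open>Z\<close>, glued from the \<open>Y j\<close>. Integrating by parts on each
  layer leaves only the boundary terms, which the impedance conditions of \<open>Z\<close> cancel, and the
  defect of the equation in layer \<open>m + 1\<close>.\<close>

proposition solution_vs_test_function:
  fixes Y Y' Y'' :: "nat \<Rightarrow> real \<Rightarrow> complex"
  assumes sol: "helmholtz_solution \<omega> cs u"
    and Y: "\<And>j t. (Y j has_vector_derivative Y' j t) (at t)"
    and Y': "\<And>j t. (Y' j has_vector_derivative Y'' j t) (at t)"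
    and smooth: "\<And>j. smooth_fn (\<lambda>t. Re (Y' j t))" "\<And>j. smooth_fn (\<lambda>t. Im (Y' j t))"
    and cont: "\<And>j. continuous_on UNIV (Y'' j)"
    and match: "\<And>j. j < n \<Longrightarrow> Y (Suc j) (x (Suc j)) = Y (Suc (Suc j)) (x (Suc j))"
      "\<And>j. j < n \<Longrightarrow> Y' (Suc j) (x (Suc j)) = Y' (Suc (Suc j)) (x (Suc j))"
    and ode: "\<And>j t. j \<le> n \<Longrightarrow> j \<noteq> m \<Longrightarrow> Y'' (Suc j) t + (w (Suc j))\<^sup>2 * Y (Suc j) t = 0"
    and m: "m \<le> n" and defect: "\<And>t. cmod (Y'' (Suc m) t + (w (Suc m))\<^sup>2 * Y (Suc m) t) \<le> M"
    and impedance: "Y' (Suc 0) (-1) = - \<i> * w 1 * Y (Suc 0) (-1)"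
      "Y' (Suc n) 1 = \<i> * w (Suc n) * Y (Suc n) 1"
  shows "cmod (Y (Suc n) 1) \<le> M * integral {x m..x (Suc m)} (\<lambda>t. cmod (u t))"
proof -
  have Y_cont: "continuous_on S (Y j)" "continuous_on S (Y' j)" "continuous_on S (Y'' j)" for j S
    by (intro continuous_at_imp_continuous_on ballI has_vector_derivative_continuous[OF Y],
        intro continuous_at_imp_continuous_on ballI has_vector_derivative_continuous[OF Y'],
        rule continuous_on_subset[OF cont], simp)
  have "\<exists>Z Z'. (\<forall>t. (Z has_vector_derivative Z' t) (at t)) \<and> continuous_on UNIV Z' \<and>
    (\<forall>t\<ge>x n. Z t = Y (Suc n) t \<and> Z' t = Y' (Suc n) t) \<and>
    (\<forall>j<n. \<forall>t\<in>{x j..x (Suc j)}. Z t = Y (Suc j) t \<and> Z' t = Y' (Suc j) t)"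
    by (rule continuously_differentiable_glue[where Y = Y and Y' = Y' and x = x])
       (use Y Y_cont(2) incr match in simp_all)
  then obtain Z Z' where ZP: "(\<forall>t. (Z has_vector_derivative Z' t) (at t)) \<and> continuous_on UNIV Z' \<and>
    (\<forall>t\<ge>x n. Z t = Y (Suc n) t \<and> Z' t = Y' (Suc n) t) \<and>
    (\<forall>j<n. \<forall>t\<in>{x j..x (Suc j)}. Z t = Y (Suc j) t \<and> Z' t = Y' (Suc j) t)"
    by (elim exE)
  have Z: "\<And>t. (Z has_vector_derivative Z' t) (at t)" "continuous_on UNIV Z'"
    using ZP by simp_all
  have Z_eq: "Z t = Y (Suc j) t" "Z' t = Y' (Suc j) t" if "j \<le> n" "t \<in> {x j..x (Suc j)}" for j t
    using ZP that by (cases "j = n"; simp)+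
  define z where "z = (\<lambda>t. cnj (Z t))"
  have z: "(z has_vector_derivative cnj (Z' t)) (at t)" for t
    unfolding z_def by (rule has_vector_derivative_cnj[OF Z(1)])
  have z'_cont: "continuous_on UNIV (\<lambda>t. cnj (Z' t))"
    by (intro continuous_intros Z(2))
  have z_H1: "H1 z" and "\<exists>N. negligible N \<and> (\<forall>t\<in>{-1..1} - N. weak_deriv z t = cnj (Z' t))"
    by (rule continuously_differentiable_imp_H1[OF z z'_cont])+
  then obtain N where N: "negligible N" "\<And>t. t \<in> {-1..1} - N \<Longrightarrow> weak_deriv z t = cnj (Z' t)"
    by blast
  define g where "g = weak_deriv u"
  have u: "H1 u" "continuous_on {-1..1} u"
    using sol by (simp_all add: helmholtz_solution_def H1_def)
  have g: "L2 g" "has_weak_deriv u g"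
    using weak_deriv_H1[OF u(1)] by (simp_all add: g_def)
  define f where "f = (\<lambda>t. g t * cnj (weak_deriv z t) - complex_of_real ((\<omega> / cs t)\<^sup>2) * u t * cnj (z t))"
  \<comment> \<open>\<open>E j\<close> pairs \<open>u\<close> with the residual of the Helmholtz
    equation for the piece on layer \<open>Suc j\<close>; it survives only for
    \<open>j = m\<close>.\<close>
  define E where "E = (\<lambda>j. integral {x j..x (Suc j)}
    (\<lambda>t. u t * (Y'' (Suc j) t + (w (Suc j))\<^sup>2 * Y (Suc j) t)))"
  have layer: "f absolutely_integrable_on {x j..x (Suc j)}"
    "integral {x j..x (Suc j)} f = (u (x (Suc j)) * Z' (x (Suc j)) - u (x j) * Z' (x j)) - E j"
    if j: "j \<le> n" for j
  proof -
    let ?I = "{x j..x (Suc j)}" and ?W = "complex_of_real ((w (Suc j))\<^sup>2)"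
    have u_cont: "continuous_on ?I u"
      by (rule continuous_on_subset[OF u(2) layer_subset[OF j]])
    have gY: "(\<lambda>t. g t * Y' (Suc j) t) absolutely_integrable_on ?I"
      using layer_subset[OF j]
      by (intro absolutely_integrable_mult_continuous Y_cont
          absolutely_integrable_on_subinterval[OF L2_imp_absolutely_integrable[OF g(1)]])
    have uY: "(\<lambda>t. u t * (?W * Y (Suc j) t)) absolutely_integrable_on ?I"
      "(\<lambda>t. u t * Y'' (Suc j) t) absolutely_integrable_on ?I"
      by (intro absolutely_integrable_continuous_real continuous_intros u_cont Y_cont)+
    have diff: "(\<lambda>t. g t * Y' (Suc j) t - u t * (?W * Y (Suc j) t)) absolutely_integrable_on ?I"
      by (rule set_integral_diff(1)[OF gY uY(1)])
    \<comment> \<open>The exceptional set collects the points where the chosen weak derivative of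
      \<open>z\<close> may differ from the classical one and the nodes, where the speed is
      arbitrary.\<close>
    have eq: "f t = g t * Y' (Suc j) t - u t * (?W * Y (Suc j) t)" if "t \<in> ?I - (N \<union> {x j, x (Suc j)})" for t
    proof -
      have "t \<in> {-1..1} - N" "t \<in> ?I" "t \<in> {x j<..<x (Suc j)}"
        using that layer_subset[OF j] by auto
      then have "complex_of_real ((\<omega> / cs t)\<^sup>2) = ?W" "weak_deriv z t = cnj (Y' (Suc j) t)"
          "z t = cnj (Y (Suc j) t)"
        using wavenumber[OF j, of t] N(2)[of t] Z_eq[OF j, of t] by (simp_all only: z_def)
      then show ?thesis
        by (simp add: f_def)
    qed
    have null: "negligible (N \<union> {x j, x (Suc j)})"
      using N(1) by simp
    show "f absolutely_integrable_on ?I"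
      by (rule absolutely_integrable_spike[OF diff null eq])
    have ends: "x j \<in> ?I" "x (Suc j) \<in> ?I"
      using incr[OF j] by auto
    have "integral ?I f = integral ?I (\<lambda>t. g t * Y' (Suc j) t - u t * (?W * Y (Suc j) t))"
      by (rule integral_spike[OF null eq[symmetric]])
    also have "\<dots> = integral ?I (\<lambda>t. g t * Y' (Suc j) t) - integral ?I (\<lambda>t. u t * (?W * Y (Suc j) t))"
      using gY uY by (intro integral_diff) (simp_all add: absolutely_integrable_on_def)
    also have "integral ?I (\<lambda>t. g t * Y' (Suc j) t) = u (x (Suc j)) * Y' (Suc j) (x (Suc j)) -
        u (x j) * Y' (Suc j) (x j) - integral ?I (\<lambda>t. u t * Y'' (Suc j) t)"
      using layer_subset[OF j] ends incr[OF j]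
      by (intro weak_integration_by_parts_complex[OF u(2) g smooth Y']) auto
    also have "\<dots> - integral ?I (\<lambda>t. u t * (?W * Y (Suc j) t)) =
        (u (x (Suc j)) * Y' (Suc j) (x (Suc j)) - u (x j) * Y' (Suc j) (x j)) -
        (integral ?I (\<lambda>t. u t * Y'' (Suc j) t) + integral ?I (\<lambda>t. u t * (?W * Y (Suc j) t)))"
      by simp
    also have "integral ?I (\<lambda>t. u t * Y'' (Suc j) t) + integral ?I (\<lambda>t. u t * (?W * Y (Suc j) t)) =
        integral ?I (\<lambda>t. u t * Y'' (Suc j) t + u t * (?W * Y (Suc j) t))"
      using uY by (intro integral_add[symmetric]) (simp_all add: absolutely_integrable_on_def)
    also have "\<dots> = E j"
      by (simp add: E_def distrib_left)
    finally show "integral ?I f = (u (x (Suc j)) * Z' (x (Suc j)) - u (x j) * Z' (x j)) - E j"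
      using Z_eq(2)[OF j] ends by simp
  qed
  have E0: "E j = 0" if "j \<le> n" "j \<noteq> m" for j
    unfolding E_def ode[OF that] by simp
  have "integral {-1..1} f = (\<Sum>j<Suc n. integral {x j..x (Suc j)} f)"
    by (rule sum_layers(2)[OF layer(1)])
  also have "\<dots> = (\<Sum>j<Suc n. (u (x (Suc j)) * Z' (x (Suc j)) - u (x j) * Z' (x j)) - E j)"
    using layer(2) by (intro sum.cong) auto
  also have "\<dots> = (\<Sum>j<Suc n. u (x (Suc j)) * Z' (x (Suc j)) - u (x j) * Z' (x j)) - (\<Sum>j<Suc n. E j)"
    by (rule sum_subtractf)
  \<comment> \<open>The derivative of the glued function is single-valued at the nodes, so the
    interior boundary terms telescope away.\<close>
  also have "(\<Sum>j<Suc n. u (x (Suc j)) * Z' (x (Suc j)) - u (x j) * Z' (x j)) =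
      u 1 * Z' 1 - u (-1) * Z' (-1)"
    using sum_lessThan_telescope[of "\<lambda>j. u (x j) * Z' (x j)" "Suc n"] first last by simp
  also have "(\<Sum>j<Suc n. E j) = (\<Sum>j\<in>{m}. E j)"
    using m E0 by (intro sum.mono_neutral_right) auto
  finally have int_f: "(LINT t:Omega|lebesgue. f t) = u 1 * Z' 1 - u (-1) * Z' (-1) - E m"
    using set_lebesgue_integral_Omega[OF sum_layers(1)[OF layer(1)]] by simp
  have ends: "Z 1 = Y (Suc n) 1" "Z' 1 = Y' (Suc n) 1" "Z (-1) = Y (Suc 0) (-1)" "Z' (-1) = Y' (Suc 0) (-1)"
    using Z_eq[of n 1] Z_eq[of 0 "-1"] incr[of n] incr[of 0] first last by auto
  have "helmholtz_form \<omega> cs u z = (LINT t:Omega|lebesgue. f t) - \<i> *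
      (complex_of_real (\<omega> / cs (-1)) * u (-1) * Z (-1) + complex_of_real (\<omega> / cs 1) * u 1 * Z 1)"
    unfolding helmholtz_form_def f_def g_def z_def by simp
  moreover have "helmholtz_form \<omega> cs u z = Z 1"
    using sol z_H1 by (simp add: helmholtz_solution_def z_def)
  ultimately have "(LINT t:Omega|lebesgue. f t) - \<i> *
      (w 1 * u (-1) * Z (-1) + w (Suc n) * u 1 * Z 1) = Z 1"
    unfolding wavenumber_first wavenumber_last by simp
  \<comment> \<open>The impedance conditions make \<open>u 1 * Z' 1\<close> and
    \<open>- u (-1) * Z' (-1)\<close> cancel the two terms of the sesquilinear form at the
    endpoints.\<close>
  then have "Y (Suc n) 1 = - E m"
    unfolding int_f ends impedance by (simp add: algebra_simps)
  then have "cmod (Y (Suc n) 1) = cmod (E m)"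
    by simp
  also have "\<dots> \<le> integral {x m..x (Suc m)} (\<lambda>t. M * cmod (u t))"
    unfolding E_def
  proof (rule integral_norm_bound_integral)
    have u_cont: "continuous_on {x m..x (Suc m)} u"
      by (rule continuous_on_subset[OF u(2) layer_subset[OF m]])
    show "(\<lambda>t. u t * (Y'' (Suc m) t + (w (Suc m))\<^sup>2 * Y (Suc m) t)) integrable_on {x m..x (Suc m)}"
      "(\<lambda>t. M * cmod (u t)) integrable_on {x m..x (Suc m)}"
      by (intro integrable_continuous_interval continuous_intros u_cont Y_cont)+
    fix t
    show "cmod (u t * (Y'' (Suc m) t + (w (Suc m))\<^sup>2 * Y (Suc m) t)) \<le> M * cmod (u t)"
      using mult_left_mono[OF defect[of t], of "cmod (u t)"] by (simp add: norm_mult mult.commute)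
  qed
  also have "\<dots> = M * integral {x m..x (Suc m)} (\<lambda>t. cmod (u t))"
    by (rule integral_mult_right)
  finally show ?thesis .
qed

end

section \<open>The quarter-wave medium\<close>

lemma smooth_fn_cos: "smooth_fn (\<lambda>t. cos (m * (t - s)))"
  using smooth_fn.affine[OF smooth_fn.cos[of 0], of m "- (m * s)"] by (simp add: right_diff_distrib)

text \<open>Sine is the cosine generator shifted by \<open>pi / 2\<close>.\<close>

lemma smooth_fn_sin: "smooth_fn (\<lambda>t. sin (m * (t - s)))"
  using smooth_fn.affine[OF smooth_fn.cos[of "- (pi / 2)"], of m "- (m * s)"]
  by (simp add: right_diff_distrib cos_diff flip: diff_conv_add_uminus)

text \<open>For \<open>\<mu> = 1\<close> the mode solves \<open>Y'' + m\<^sup>2 Y = 0\<close> with Cauchy data \<open>(v, d)\<close> at \<open>s\<close>. For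
  \<open>\<mu> = 2\<close> it violates the equation, but over half a wavelength it carries \<open>(v, d)\<close> to \<open>(-v, d)\<close>
  instead of \<open>(-v, -d)\<close>.\<close>

definition mode :: "complex \<Rightarrow> complex \<Rightarrow> real \<Rightarrow> real \<Rightarrow> real \<Rightarrow> real \<Rightarrow> complex" where
  "mode v d m \<mu> s t = v * complex_of_real (cos (m * (t - s))) +
     d * complex_of_real (sin (\<mu> * m * (t - s)) / (\<mu> * m))"

definition mode' :: "complex \<Rightarrow> complex \<Rightarrow> real \<Rightarrow> real \<Rightarrow> real \<Rightarrow> real \<Rightarrow> complex" where
  "mode' v d m \<mu> s t = v * complex_of_real (- m * sin (m * (t - s))) +
     d * complex_of_real (cos (\<mu> * m * (t - s)))"

definition mode'' :: "complex \<Rightarrow> complex \<Rightarrow> real \<Rightarrow> real \<Rightarrow> real \<Rightarrow> real \<Rightarrow> complex" where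
  "mode'' v d m \<mu> s t = v * complex_of_real (- m\<^sup>2 * cos (m * (t - s))) +
     d * complex_of_real (- (\<mu> * m) * sin (\<mu> * m * (t - s)))"

lemma has_vector_derivative_mode:
  assumes "\<mu> * m \<noteq> 0"
  shows "(mode v d m \<mu> s has_vector_derivative mode' v d m \<mu> s t) (at t)"
proof -
  have "((\<lambda>t. cos (m * (t - s))) has_real_derivative - m * sin (m * (t - s))) (at t)"
    by (auto intro!: derivative_eq_intros)
  moreover have "((\<lambda>t. sin (\<mu> * m * (t - s)) / (\<mu> * m)) has_real_derivative cos (\<mu> * m * (t - s))) (at t)"
    using assms by (auto intro!: derivative_eq_intros)
  ultimately show ?thesis
    unfolding mode_def mode'_def
    by (intro has_vector_derivative_add has_vector_derivative_mult_right has_vector_derivative_of_real)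
qed

lemma has_vector_derivative_mode':
  "(mode' v d m \<mu> s has_vector_derivative mode'' v d m \<mu> s t) (at t)"
proof -
  have "((\<lambda>t. - m * sin (m * (t - s))) has_real_derivative - m\<^sup>2 * cos (m * (t - s))) (at t)"
    by (auto intro!: derivative_eq_intros simp: power2_eq_square)
  moreover have "((\<lambda>t. cos (\<mu> * m * (t - s))) has_real_derivative
      - (\<mu> * m) * sin (\<mu> * m * (t - s))) (at t)"
    by (auto intro!: derivative_eq_intros)
  ultimately show ?thesis
    unfolding mode'_def mode''_def
    by (intro has_vector_derivative_add has_vector_derivative_mult_right has_vector_derivative_of_real)
qed

lemma smooth_fn_mode': "smooth_fn (\<lambda>t. Re (mode' v d m \<mu> s t))" "smooth_fn (\<lambda>t. Im (mode' v d m \<mu> s t))"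
proof -
  have "smooth_fn (\<lambda>t. A * sin (m * (t - s)) + B * cos (\<mu> * m * (t - s)))" for A B
    by (rule smooth_fn.add[OF smooth_fn_cmult[OF smooth_fn_sin] smooth_fn_cmult[OF smooth_fn_cos]])
  from this[of "- Re v * m" "Re d"] this[of "- Im v * m" "Im d"]
  show "smooth_fn (\<lambda>t. Re (mode' v d m \<mu> s t))" "smooth_fn (\<lambda>t. Im (mode' v d m \<mu> s t))"
    by (simp_all add: mode'_def mult.assoc)
qed

lemma continuous_on_mode'': "continuous_on S (mode'' v d m \<mu> s)"
  unfolding mode''_def by (intro continuous_intros)

lemma mode_start: "mode v d m \<mu> s s = v" "mode' v d m \<mu> s s = d"
  by (simp_all add: mode_def mode'_def)

lemma mode_quarter_wave:
  assumes "m * (t - s) = pi / 2"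
  shows "mode v d m 1 s t = d / complex_of_real m" "mode' v d m 1 s t = - complex_of_real m * v"
proof -
  have "cos (m * (t - s)) = 0" "sin (m * (t - s)) = 1"
    unfolding assms by simp_all
  then show "mode v d m 1 s t = d / complex_of_real m" "mode' v d m 1 s t = - complex_of_real m * v"
    by (simp_all add: mode_def mode'_def)
qed

text \<open>The cosine runs through half a period and changes sign, while the sine at doubled
  frequency completes a full period and recovers its slope.\<close>

lemma mode_half_wave:
  assumes "m * (t - s) = pi"
  shows "mode v d m 2 s t = - v" "mode' v d m 2 s t = d"
proof -
  have "2 * m * (t - s) = 2 * pi"
    using assms by simp
  then have "sin (2 * m * (t - s)) = 0" "cos (2 * m * (t - s)) = 1"
    by (simp_all only: sin_two_pi cos_two_pi)
  moreover have "sin (m * (t - s)) = 0" "cos (m * (t - s)) = - 1"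
    unfolding assms by simp_all
  ultimately show "mode v d m 2 s t = - v" "mode' v d m 2 s t = d"
    unfolding mode_def mode'_def by simp_all
qed

lemma mode_ode:
  assumes "m \<noteq> 0"
  shows "mode'' v d m 1 s t + m\<^sup>2 * mode v d m 1 s t = 0"
  using assms by (simp add: mode_def mode''_def power2_eq_square algebra_simps)

text \<open>The cosine part solves the equation, so only the part carrying \<open>d\<close>
  contributes: with amplitude \<open>d / (2 m)\<close> and squared frequency
  \<open>4 m\<^sup>2\<close> its residual has size at most \<open>3 m\<^sup>2\<close> times that
  amplitude. The possibly large value \<open>v\<close> does not enter the bound.\<close>

lemma mode_defect:
  assumes "m > 0"
  shows "cmod (mode'' v d m 2 s t + m\<^sup>2 * mode v d m 2 s t) \<le> 3 / 2 * m * cmod d"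
proof -
  have "mode'' v d m 2 s t + m\<^sup>2 * mode v d m 2 s t =
      complex_of_real (- (3 / 2) * m * sin (2 * m * (t - s))) * d"
    using assms by (simp add: mode_def mode''_def power2_eq_square field_simps)
  then have "cmod (mode'' v d m 2 s t + m\<^sup>2 * mode v d m 2 s t) =
      3 / 2 * m * \<bar>sin (2 * m * (t - s))\<bar> * cmod d"
    using assms by (simp only: norm_mult norm_of_real) (simp add: abs_mult)
  also have "\<dots> \<le> 3 / 2 * m * 1 * cmod d"
    using assms by (intro mult_right_mono mult_left_mono) auto
  finally show ?thesis by simp
qed

text \<open>The integral of the squared deviation of \<open>f\<close> from its mean \<open>l\<close>
  is nonnegative; expanding it gives the inequality.\<close>

lemma integral_Cauchy_Schwarz_Icc:
  fixes f :: "real \<Rightarrow> real"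
  assumes "a < b" "continuous_on {a..b} f"
  shows "(integral {a..b} f)\<^sup>2 \<le> (b - a) * integral {a..b} (\<lambda>t. (f t)\<^sup>2)"
proof -
  define I where "I = integral {a..b} f"
  define l where "l = I / (b - a)"
  have int: "f integrable_on {a..b}" "(\<lambda>t. (f t)\<^sup>2) integrable_on {a..b}"
    by (intro integrable_continuous_interval continuous_intros assms(2))+
  have "0 \<le> integral {a..b} (\<lambda>t. (f t - l)\<^sup>2)"
    by (intro Henstock_Kurzweil_Integration.integral_nonneg integrable_continuous_interval
        continuous_intros assms(2)) simp
  also have "(\<lambda>t. (f t - l)\<^sup>2) = (\<lambda>t. ((f t)\<^sup>2 - (2 * l) * f t) + l\<^sup>2)"
    by (simp add: power2_diff algebra_simps)
  also have "integral {a..b} \<dots> = integral {a..b} (\<lambda>t. (f t)\<^sup>2 - (2 * l) * f t) + integral {a..b} (\<lambda>t. l\<^sup>2)"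
    by (intro integral_add integrable_diff integrable_on_mult_right int) auto
  also have "integral {a..b} (\<lambda>t. (f t)\<^sup>2 - (2 * l) * f t) =
      integral {a..b} (\<lambda>t. (f t)\<^sup>2) - (2 * l) * I"
    unfolding I_def
    by (subst integral_diff) (auto intro: int integrable_on_mult_right)
  also have "integral {a..b} (\<lambda>t. l\<^sup>2) = (b - a) * l\<^sup>2"
    using assms(1) by simp
  finally have "0 \<le> (b - a) * (integral {a..b} (\<lambda>t. (f t)\<^sup>2) - 2 * l * I + (b - a) * l\<^sup>2)"
    using assms(1) by (intro mult_nonneg_nonneg) auto
  also have "\<dots> = (b - a) * integral {a..b} (\<lambda>t. (f t)\<^sup>2) - (l * (b - a)) * (2 * I - l * (b - a))"
    by (simp add: algebra_simps power2_eq_square)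
  also have "l * (b - a) = I"
    using assms(1) by (simp add: l_def)
  finally show ?thesis
    by (simp add: I_def power2_eq_square)
qed

section \<open>Propagation of Cauchy data through the layers\<close>

text \<open>\<open>transfer w k (v, d) j\<close> are the Cauchy data \<open>(Z, Z')\<close> at the \<open>j\<close>-th node of the test function that
  starts with \<open>(v, d)\<close>. The case \<open>j = k\<close> is the half-wave layer with \<open>\<mu> = 2\<close>.\<close>

primrec transfer :: "(nat \<Rightarrow> real) \<Rightarrow> nat \<Rightarrow> complex \<times> complex \<Rightarrow> nat \<Rightarrow> complex \<times> complex" where
  "transfer w k vd 0 = vd"
| "transfer w k vd (Suc j) = (if j = k then (- fst (transfer w k vd j), snd (transfer w k vd j))
     else (snd (transfer w k vd j) / w (Suc j), - w (Suc j) * fst (transfer w k vd j)))"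

text \<open>For \<open>k > 0\<close> this is the frequency divided by the speed of layer
  \<open>j\<close>. The frequency cancels because the speeds are proportional to it.\<close>

definition medium_wavenumber :: "real \<Rightarrow> nat \<Rightarrow> nat \<Rightarrow> real" where
  "medium_wavenumber q k j = pi * (1 - q + real k) / (2 * (if odd j then 1 - q else 1 + q))"

lemma medium_wavenumber_even:
  assumes "0 < q" "q < 1" "odd i" "even j"
  shows "medium_wavenumber q k j = (1 - q) / (1 + q) * medium_wavenumber q k i"
proof -
  have "P / (2 * t) = s / t * (P / (2 * s))" if "s \<noteq> 0" for P s t :: real
    using that by simp
  from this[of "1 - q" _ "1 + q"] show ?thesis
    using assms by (simp only: medium_wavenumber_def if_True if_False not_False_eq_True) simp
qed

text \<open>One quarter wave exchanges the roles of value and derivative, so two of them in a row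
  act diagonally. Pairs of layers are therefore the unit of the inductions below.\<close>

lemma transfer_Suc_Suc:
  assumes "j \<noteq> k" "Suc j \<noteq> k"
  shows "transfer w k vd (Suc (Suc j)) =
    (- of_real (w (Suc j)) * fst (transfer w k vd j) / of_real (w (Suc (Suc j))),
     - of_real (w (Suc (Suc j))) * snd (transfer w k vd j) / of_real (w (Suc j)))"
  using assms by simp

text \<open>Before the central layer each pair has wavenumbers \<open>a\<close> and then
  \<open>r * a\<close>, so it multiplies the value by \<open>- 1 / r\<close> and the derivative by
  \<open>- r\<close>.\<close>

lemma transfer_left:
  assumes "0 < q" "q < 1" "2 * i \<le> k" and r: "r = (1 - q) / (1 + q)"
    and a: "a = medium_wavenumber q k 1"
  shows "transfer (medium_wavenumber q k) k (1, - \<i> * a) (2 * i) =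
    ((complex_of_real (- 1 / r)) ^ i, - \<i> * a * (complex_of_real (- r)) ^ i)"
  using assms(3)
proof (induction i)
  case (Suc i)
  let ?w = "medium_wavenumber q k" and ?vd = "(1, - \<i> * complex_of_real a)"
  have w: "medium_wavenumber q k (Suc (2 * i)) = a" "medium_wavenumber q k (Suc (Suc (2 * i))) = r * a"
    unfolding a r by (simp add: medium_wavenumber_def)
      (rule medium_wavenumber_even[OF assms(1,2)]; simp)
  have nz: "r \<noteq> 0" "a \<noteq> 0"
    using assms(1,2) by (simp_all add: medium_wavenumber_def a r)
  have ne: "2 * i \<noteq> k" "Suc (2 * i) \<noteq> k"
    using Suc.prems by auto
  have IH: "transfer ?w k ?vd (2 * i) =
      ((complex_of_real (- 1 / r)) ^ i, - \<i> * a * (complex_of_real (- r)) ^ i)"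
    using Suc by simp
  have "transfer ?w k ?vd (Suc (Suc (2 * i))) =
      ((complex_of_real (- 1 / r)) ^ Suc i, - \<i> * a * (complex_of_real (- r)) ^ Suc i)"
    unfolding transfer_Suc_Suc[OF ne] w IH using nz by (simp add: field_simps)
  then show ?case
    by (simp only: mult_Suc_right add_2_eq_Suc)
qed simp

text \<open>The central layer negates only the value. As \<open>k\<close> is even, the pairs after
  it begin with an even layer; their wavenumbers come in the reverse order \<open>r * a\<close>,
  \<open>a\<close>, and each pair undoes one pair from the left half. For \<open>i = p\<close> the
  data are \<open>-1\<close> and \<open>- \<i> * a\<close>, which satisfy the condition at the right
  end.\<close>

lemma transfer_right:
  assumes "0 < q" "q < 1" "i \<le> p" and k: "k = 2 * p" and r: "r = (1 - q) / (1 + q)"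
    and a: "a = medium_wavenumber q k 1"
  shows "transfer (medium_wavenumber q k) k (1, - \<i> * a) (Suc (k + 2 * i)) =
    (- ((complex_of_real (- 1 / r)) ^ (p - i)), - \<i> * a * (complex_of_real (- r)) ^ (p - i))"
  using assms(3)
proof (induction i)
  case 0
  then show ?case
    using transfer_left[OF assms(1,2) _ r a, of p] by (simp add: k)
next
  case (Suc i)
  let ?w = "medium_wavenumber q k" and ?vd = "(1, - \<i> * complex_of_real a)"
  have w: "medium_wavenumber q k (Suc (Suc (k + 2 * i))) = r * a"
      "medium_wavenumber q k (Suc (Suc (Suc (k + 2 * i)))) = a"
    unfolding a r by (rule medium_wavenumber_even[OF assms(1,2)]; simp add: k)
      (simp add: medium_wavenumber_def k)
  have nz: "r \<noteq> 0" "a \<noteq> 0"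
    using assms(1,2) by (simp_all add: medium_wavenumber_def a r)
  \<comment> \<open>Writing \<open>p - i\<close> as a successor exposes the power that the next pair
    cancels and avoids truncated subtraction.\<close>
  obtain e where e: "p - i = Suc e" "p - Suc i = e"
    using Suc.prems by (metis Suc_diff_Suc Suc_le_eq)
  have ne: "Suc (k + 2 * i) \<noteq> k" "Suc (Suc (k + 2 * i)) \<noteq> k"
    by auto
  have IH: "transfer ?w k ?vd (Suc (k + 2 * i)) =
      (- ((complex_of_real (- 1 / r)) ^ Suc e), - \<i> * a * (complex_of_real (- r)) ^ Suc e)"
    using Suc e by simp
  have "transfer ?w k ?vd (Suc (Suc (Suc (k + 2 * i)))) =
      (- ((complex_of_real (- 1 / r)) ^ e), - \<i> * a * (complex_of_real (- r)) ^ e)"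
    unfolding transfer_Suc_Suc[OF ne] w IH using nz by (simp add: field_simps)
  then show ?case
    by (simp only: mult_Suc_right add_2_eq_Suc add_Suc_right e(2))
qed

section \<open>Wavenumbers, widths and nodes in closed form\<close>

lemma layer_speed_eq:
  assumes "0 < q" "q < 1" "0 < k"
  shows "real k / layer_speed q k j = medium_wavenumber q k j"
proof -
  have "k / (2 * k / T * s) = T / (2 * s)" if "k \<noteq> 0" for k T s :: real
    using that by simp
  from this[of "real k"] show ?thesis
    using assms(3) by (simp add: layer_speed_def medium_wavenumber_def Let_def del: times_divide_eq_left)
qed

lemma layer_width_eq:
  assumes "0 < q" "q < 1" "0 < k"
  shows "layer_width q k j = (if j = k + 1 then pi else pi / 2) / medium_wavenumber q k j"
  using assms by (simp add: layer_width_def flip: layer_speed_eq[OF assms, of j])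

lemma layer_width_closed_form:
  assumes "0 < q" "q < 1" "0 < k"
  shows "layer_width q k j =
    (if j = k + 1 then 2 else 1) * (if odd j then 1 - q else 1 + q) / (1 - q + real k)"
proof -
  have "pi / (pi * T / (2 * s)) = 2 * s / T" "pi / 2 / (pi * T / (2 * s)) = s / T" for T s :: real
    by simp_all
  then show ?thesis
    unfolding layer_width_eq[OF assms] medium_wavenumber_def
    by (simp del: distrib_left_numeral right_diff_distrib_numeral)
qed

lemma medium_wavenumber_pos: "0 < q \<Longrightarrow> q < 1 \<Longrightarrow> 0 < medium_wavenumber q k j"
  by (simp add: medium_wavenumber_def)

lemma node_less: "0 < q \<Longrightarrow> q < 1 \<Longrightarrow> 0 < k \<Longrightarrow> node q k j < node q k (Suc j)"
  using medium_wavenumber_pos[of q k "Suc j"] by (simp add: layer_width_eq)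

text \<open>An odd and an even quarter-wave layer together have width
  \<open>((1 - q) + (1 + q)) / (1 - q + k)\<close>, in which \<open>q\<close> cancels from the
  numerator.\<close>

lemma node_left:
  assumes "0 < q" "q < 1" "0 < k" "2 * i \<le> k"
  shows "node q k (2 * i) = -1 + 2 * real i / (1 - q + real k)"
  using assms(4)
proof (induction i)
  case (Suc i)
  then show ?case
    by (simp add: layer_width_closed_form[OF assms(1-3)] add_divide_distrib diff_divide_distrib)
qed simp

text \<open>The central layer adds \<open>2 * (1 - q) / (1 - q + k)\<close> and each later pair
  again \<open>2 / (1 - q + k)\<close>. At \<open>i = p\<close> the numerator is twice the
  denominator, which puts the last node at 1.\<close>

lemma node_right:
  assumes "0 < q" "q < 1" "0 < p" and k: "k = 2 * p"
  shows "node q k (Suc (k + 2 * i)) = -1 + 2 * (real p + real i + 1 - q) / (1 - q + real k)"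
proof (induction i)
  case 0
  have "node q k k = -1 + 2 * real p / (1 - q + real k)"
    using node_left[OF assms(1,2), of k p] assms(3) by (simp add: k)
  then show ?case
    using assms by (simp add: layer_width_closed_form add_divide_distrib diff_divide_distrib)
next
  case (Suc i)
  then show ?case
    using assms by (simp add: layer_width_closed_form add_divide_distrib diff_divide_distrib)
qed

lemma node_last:
  assumes "0 < q" "q < 1" "0 < k" "even k"
  shows "node q k (Suc (2 * k)) = 1"
proof -
  obtain p where p: "k = 2 * p"
    using assms(4) by (elim evenE)
  have "1 - q + 2 * real p \<noteq> 0"
    using assms(2) by linarith
  then show ?thesis
    using node_right[OF assms(1,2) _ p, of p] assms(3) by (simp add: p field_simps)
qed

section \<open>The exponential lower bound\<close>

lemma energy_norm_nonneg: "0 \<le> energy_norm \<omega> cs u"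
  unfolding energy_norm_def set_lebesgue_integral_def
  by (intro real_sqrt_ge_zero integral_nonneg_AE) simp

text \<open>Squaring the duality bound turns the decay \<open>r ^ p\<close> of the defect into
  \<open>r ^ k\<close>. One factor \<open>a\<close>, of order \<open>k\<close>, is left over and
  accounts for \<open>k\<close> in the denominator.\<close>

proposition energy_norm_lower_bound:
  assumes q: "0 < q" "q < 1" and k: "even k" "2 \<le> k"
    and speed: "layered_speed (2 * k + 1) (node q k) (layer_speed q k) cs"
    and sol: "helmholtz_solution (real k) cs u"
  shows "4 * (1 - q) / (9 * pi\<^sup>2 * real k) \<le> ((1 - q) / (1 + q)) ^ k * (energy_norm (real k) cs u)\<^sup>2"
proof -
  obtain p where p: "k = 2 * p"
    using k(1) by (elim evenE)
  have k0: "0 < k"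
    using k(2) by simp
  define x where "x = node q k"
  define w where "w = medium_wavenumber q k"
  define r where "r = (1 - q) / (1 + q)"
  define a where "a = w 1"
  have w_pos: "w j > 0" for j
    unfolding w_def by (rule medium_wavenumber_pos[OF q])
  have a_pos: "a > 0" and r_pos: "r > 0"
    using w_pos q by (simp_all add: a_def r_def)
  have w_mid: "w (Suc k) = a" and w_last: "w (Suc (2 * k)) = a"
    using k(1) by (simp_all add: w_def a_def medium_wavenumber_def)
  interpret layered_medium x w "2 * k" "real k" cs
  proof
    show "x 0 = -1" "x (Suc (2 * k)) = 1"
      using node_last[OF q k0 k(1)] by (simp_all add: x_def)
    show "x j < x (Suc j)" for j
      unfolding x_def by (rule node_less[OF q k0])
    show "real k / cs t = w (Suc j)" if "j \<le> 2 * k" "t \<in> {x j<..<x (Suc j)}" for j t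
    proof -
      have "Suc j \<in> {1..2 * k + 1}" "t \<in> {node q k (Suc j - 1)<..<node q k (Suc j)}"
        using that by (simp_all add: x_def)
      then have "cs t = layer_speed q k (Suc j)"
        using speed unfolding layered_speed_def by blast
      then show ?thesis
        using layer_speed_eq[OF q k0] by (simp add: w_def)
    qed
    show "real k / cs (-1) = w 1" "real k / cs 1 = w (Suc (2 * k))"
      using speed layer_speed_eq[OF q k0] by (simp_all add: layered_speed_def w_def)
  qed
  define st where "st = transfer w k (1, - \<i> * a)"
  define v d where "v = (\<lambda>j. fst (st j))" and "d = (\<lambda>j. snd (st j))"
  \<comment> \<open>The index is that of the left node, so \<open>j = k\<close> marks the central
    layer, whose number is \<open>k + 1\<close>.\<close>
  define \<mu> :: "nat \<Rightarrow> real" where "\<mu> = (\<lambda>j. if j = k then 2 else 1)"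
  \<comment> \<open>Piece \<open>j\<close> starts at node \<open>j - 1\<close>. Truncated
    subtraction makes \<open>Y 0\<close> a mode based at node 0, so the derivative facts hold for
    every index.\<close>
  define Y where "Y = (\<lambda>j. mode (v (j - 1)) (d (j - 1)) (w j) (\<mu> (j - 1)) (x (j - 1)))"
  define Y' where "Y' = (\<lambda>j. mode' (v (j - 1)) (d (j - 1)) (w j) (\<mu> (j - 1)) (x (j - 1)))"
  define Y'' where "Y'' = (\<lambda>j. mode'' (v (j - 1)) (d (j - 1)) (w j) (\<mu> (j - 1)) (x (j - 1)))"
  have start: "Y (Suc j) (x j) = v j" "Y' (Suc j) (x j) = d j" for j
    by (simp_all add: Y_def Y'_def mode_start)
  have stop: "Y (Suc j) (x (Suc j)) = v (Suc j)" "Y' (Suc j) (x (Suc j)) = d (Suc j)" for j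
  proof -
    have "x (Suc j) - x j = (if j = k then pi else pi / 2) / w (Suc j)"
      by (simp add: x_def w_def layer_width_eq[OF q k0])
    then have width: "w (Suc j) * (x (Suc j) - x j) = (if j = k then pi else pi / 2)"
      using w_pos[of "Suc j"] by simp
    show "Y (Suc j) (x (Suc j)) = v (Suc j)" "Y' (Suc j) (x (Suc j)) = d (Suc j)"
      using width mode_half_wave[of "w (Suc j)" "x (Suc j)" "x j"]
        mode_quarter_wave[of "w (Suc j)" "x (Suc j)" "x j"]
      by (cases "j = k"; simp add: Y_def Y'_def \<mu>_def v_def d_def st_def)+
  qed
  have st_left: "st k = ((complex_of_real (- 1 / r)) ^ p, - \<i> * a * (complex_of_real (- r)) ^ p)"
    using transfer_left[OF q _ r_def, of p k a] by (simp add: st_def w_def a_def p)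
  have st_right: "st (Suc (2 * k)) = (- 1, - \<i> * a)"
    using transfer_right[OF q _ p r_def, of p a] by (simp add: st_def w_def a_def p)
  \<comment> \<open>This is the bound of \<open>mode_defect\<close> with wavenumber \<open>a\<close>
    and incoming derivative of modulus \<open>a * r ^ p\<close>.\<close>
  define M where "M = 3 / 2 * a * (a * r ^ p)"
  define I where "I = integral {x k..x (Suc k)} (\<lambda>t. cmod (u t))"
  define J where "J = integral {x k..x (Suc k)} (\<lambda>t. (cmod (u t))\<^sup>2)"
  have "cmod (Y (Suc (2 * k)) 1) \<le> M * I"
    unfolding I_def
  proof (rule solution_vs_test_function[OF sol])
    show "(Y j has_vector_derivative Y' j t) (at t)" for j t
      unfolding Y_def Y'_def
      by (rule has_vector_derivative_mode) (use w_pos[of j] in \<open>simp add: \<mu>_def\<close>)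
    show "(Y' j has_vector_derivative Y'' j t) (at t)" for j t
      unfolding Y'_def Y''_def by (rule has_vector_derivative_mode')
    show "smooth_fn (\<lambda>t. Re (Y' j t))" "smooth_fn (\<lambda>t. Im (Y' j t))" for j
      unfolding Y'_def by (rule smooth_fn_mode')+
    show "continuous_on UNIV (Y'' j)" for j
      unfolding Y''_def by (rule continuous_on_mode'')
    show "Y (Suc j) (x (Suc j)) = Y (Suc (Suc j)) (x (Suc j))"
      "Y' (Suc j) (x (Suc j)) = Y' (Suc (Suc j)) (x (Suc j))" for j
      by (simp_all only: start stop)
    show "Y'' (Suc j) t + (w (Suc j))\<^sup>2 * Y (Suc j) t = 0" if "j \<noteq> k" for j t
      using that w_pos[of "Suc j"] mode_ode[of "w (Suc j)"] by (simp add: Y_def Y''_def \<mu>_def)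
    show "cmod (Y'' (Suc k) t + (w (Suc k))\<^sup>2 * Y (Suc k) t) \<le> M" for t
    proof -
      have "cmod (d k) = a * r ^ p"
        using a_pos r_pos by (simp add: d_def st_left norm_mult norm_power)
      then show ?thesis
        using mode_defect[OF a_pos, of "v k" "d k" "x k" t]
        by (simp add: Y_def Y''_def \<mu>_def w_mid M_def mult.assoc)
    qed
    show "Y' (Suc 0) (-1) = - \<i> * w 1 * Y (Suc 0) (-1)"
      using start[of 0] first by (simp add: v_def d_def st_def a_def)
    show "Y' (Suc (2 * k)) 1 = \<i> * w (Suc (2 * k)) * Y (Suc (2 * k)) 1"
      using stop[of "2 * k"] last by (simp add: v_def d_def st_right w_last)
  qed simp
  moreover have "Y (Suc (2 * k)) 1 = - 1"
    using stop[of "2 * k"] last by (simp add: v_def st_right)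
  ultimately have "1 \<le> M * I"
    by simp
  then have "1\<^sup>2 \<le> (M * I)\<^sup>2"
    by (intro power_mono) auto
  also have "\<dots> = M\<^sup>2 * I\<^sup>2"
    by (rule power_mult_distrib)
  also have "\<dots> \<le> M\<^sup>2 * ((x (Suc k) - x k) * J)"
  proof (rule mult_left_mono)
    have "continuous_on {-1..1} u"
      using sol by (simp add: helmholtz_solution_def H1_def)
    then have "continuous_on {x k..x (Suc k)} (\<lambda>t. cmod (u t))"
      using layer_subset[of k] by (intro continuous_on_norm) (auto intro: continuous_on_subset)
    then show "I\<^sup>2 \<le> (x (Suc k) - x k) * J"
      unfolding I_def J_def using incr[of k]
      by (intro integral_Cauchy_Schwarz_Icc) simp_all
  qed simp
  also have "x (Suc k) - x k = pi / a"
    using w_mid by (simp add: x_def layer_width_eq[OF q k0] w_def)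
  \<comment> \<open>Two of the remaining factors \<open>a\<close> are grouped with \<open>J\<close>,
    since \<open>a\<^sup>2 * J\<close> is the part of the energy controlled by
    \<open>energy_norm_layer\<close>.\<close>
  also have "M\<^sup>2 * (pi / a * J) = 9 / 4 * pi * a * r ^ k * (a\<^sup>2 * J)"
    using a_pos by (simp add: M_def p power_mult power_mult_distrib power2_eq_square field_simps)
  also have "\<dots> \<le> 9 / 4 * pi * a * r ^ k * (energy_norm (real k) cs u)\<^sup>2"
  proof (rule mult_left_mono)
    show "a\<^sup>2 * J \<le> (energy_norm (real k) cs u)\<^sup>2"
      using energy_norm_layer[of u k] sol w_mid by (simp add: J_def helmholtz_solution_def)
  qed (use a_pos r_pos in simp)
  also have "\<dots> = a * (9 / 4 * pi * (r ^ k * (energy_norm (real k) cs u)\<^sup>2))"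
    by simp
  also have "\<dots> \<le> (pi * real k / (1 - q)) * (9 / 4 * pi * (r ^ k * (energy_norm (real k) cs u)\<^sup>2))"
  proof (rule mult_right_mono)
    have "a = pi * (1 - q + real k) / (2 * (1 - q))"
      by (simp add: a_def w_def medium_wavenumber_def)
    \<comment> \<open>Here \<open>1 - q\<close> is below 1 and hence below \<open>k\<close>.\<close>
    also have "\<dots> \<le> pi * (2 * real k) / (2 * (1 - q))"
      using q k0 by (intro divide_right_mono mult_left_mono) auto
    also have "\<dots> = pi * real k / (1 - q)"
      by (simp only: mult.left_commute[of pi] mult_divide_mult_cancel_left[OF zero_neq_numeral[symmetric]])
    finally show "a \<le> pi * real k / (1 - q)" .
  qed (use r_pos in simp)
  finally show ?thesis
    using q k0 by (simp add: r_def[symmetric] field_simps power2_eq_square)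
qed

theorem mainTheorem3:
  fixes q :: real
  assumes "0 < q" and "q < 1"
  shows "\<exists>C \<alpha> :: real. 0 < C \<and> 0 < \<alpha> \<and> \<alpha> < 1 \<and>
    (\<forall>k :: nat. even k \<and> 2 \<le> k \<longrightarrow>
      (let \<omega> = real k; n = 2 * k in
        node q k (n + 1) = 1 \<and>
        (\<forall>cs u. layered_speed (n + 1) (node q k) (layer_speed q k) cs \<and>
            helmholtz_solution \<omega> cs u \<longrightarrow>
          energy_norm \<omega> cs u \<ge> C * \<alpha> powr (- \<omega>))))"
proof -
  define r where "r = (1 - q) / (1 + q)"
  have r: "0 < r" "r < 1"
    using assms by (simp_all add: r_def)
  define L where "L = - ln r"
  have L: "L > 0"
    using r by (simp add: L_def)
  have exp_L: "exp (- L) = r"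
    using r by (simp add: L_def)
  \<comment> \<open>The proposition gives growth of order \<open>r powr (- k / 2)\<close> divided by
    the square root of \<open>k\<close>. Half of the exponent is spent on that square root, which
    leaves the base \<open>r powr (1 / 4)\<close>, that is \<open>exp (- L / 4)\<close>. The value
    of \<open>C\<close> collects the constants that remain.\<close>
  define C where "C = sqrt (2 * (1 - q) * L / (9 * pi\<^sup>2))"
  define \<alpha> where "\<alpha> = exp (- L / 4)"
  have C2: "C\<^sup>2 = 2 * (1 - q) * L / (9 * pi\<^sup>2)" and C: "C > 0"
    using L assms by (simp_all add: C_def)
  show ?thesis
  proof (intro exI conjI allI impI, unfold Let_def, safe)
    show "0 < C" "0 < \<alpha>" "\<alpha> < 1"
      using C L by (simp_all add: \<alpha>_def)
    fix k :: nat
    assume k: "even k" "2 \<le> k"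
    then show "node q k (2 * k + 1) = 1"
      using node_last[OF assms, of k] by simp
    fix cs u
    assume speed: "layered_speed (2 * k + 1) (node q k) (layer_speed q k) cs"
      and sol: "helmholtz_solution (real k) cs u"
    define E where "E = energy_norm (real k) cs u"
    define y where "y = exp (real k * L / 4)"
    have y: "y > 0" "\<alpha> powr (- real k) = y"
      by (simp_all add: y_def \<alpha>_def powr_def)
    have "4 * (1 - q) / (9 * pi\<^sup>2 * real k) \<le> r ^ k * E\<^sup>2"
      using energy_norm_lower_bound[OF assms k speed sol] by (simp add: r_def E_def)
    also have "r ^ k = 1 / (y\<^sup>2 * y\<^sup>2)"
    proof -
      have "r ^ k = exp (real k * (- L))"
        by (simp only: exp_of_nat_mult exp_L)
      also have "\<dots> = 1 / (y\<^sup>2 * y\<^sup>2)"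
        by (simp add: y_def exp_minus inverse_eq_divide power2_eq_square flip: exp_add)
      finally show ?thesis .
    qed
    finally have E: "4 * (1 - q) * (y\<^sup>2 * y\<^sup>2) \<le> 9 * pi\<^sup>2 * real k * E\<^sup>2"
      using y k by (simp add: field_simps)
    have "y\<^sup>2 = exp (real k * L / 2)"
      by (simp add: y_def power2_eq_square flip: exp_add)
    \<comment> \<open>As \<open>r ^ k\<close> is the reciprocal of the fourth power of
      \<open>y\<close>, one factor \<open>y\<^sup>2\<close> can absorb the loss of \<open>k\<close>
      and the other remains as the exponential bound.\<close>
    then have "real k * L / 2 \<le> y\<^sup>2"
      using exp_ge_add_one_self[of "real k * L / 2"] by linarith
    then have "(2 * (1 - q) * y\<^sup>2) * (real k * L) \<le> (2 * (1 - q) * y\<^sup>2) * (2 * y\<^sup>2)"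
      using assms by (intro mult_left_mono) auto
    also have "\<dots> = 4 * (1 - q) * (y\<^sup>2 * y\<^sup>2)"
      by (simp add: algebra_simps)
    also note E
    finally have "real k * (2 * (1 - q) * L * y\<^sup>2) \<le> real k * (9 * pi\<^sup>2 * E\<^sup>2)"
      by (simp only: mult_ac)
    then have "2 * (1 - q) * L * y\<^sup>2 \<le> 9 * pi\<^sup>2 * E\<^sup>2"
      using k by simp
    then have "(C * y)\<^sup>2 \<le> E\<^sup>2"
      by (simp add: power_mult_distrib C2 field_simps)
    then have "C * y \<le> E"
      unfolding E_def by (rule power2_le_imp_le[OF _ energy_norm_nonneg])
    then show "C * \<alpha> powr (- real k) \<le> energy_norm (real k) cs u"
      by (simp add: y E_def)
  qed
qed

end
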